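(* Let $r\ge1$, $\sigma\ge1$, $\delta\ge0$, $\alpha\in(0,1)$, and let $\rho:\mathbb{R}^d\to[0,\infty)$ be a convex penalty function such that for any $\boldsymbol\beta\in\mathbb{R}^d$ there exists a subgradient $\boldsymbol\beta^*\in\partial\rho(\boldsymbol\beta)$ with $$\left|\boldsymbol\gamma^\top\left(\boldsymbol\beta^*-\frac{\boldsymbol\beta}{\boldsymbol\beta^\top\boldsymbol\beta}\,\rho^*(\boldsymbol\beta^* )\right)\right|\le\rho(\boldsymbol\gamma)\quad\text{for all }\boldsymbol\gamma\in\mathbb{R}^d. \qquad(\ast)$$ Let $\|\cdot\|$ be a norm on $\mathbb{R}^{d+1}$ with dual norm $\|\cdot\|_*$ and $c_d>0$ a constant with $c_d\|(\boldsymbol\gamma,-1)\|\le\rho(\boldsymbol\gamma)+1$ for all $\boldsymbol\gamma\in\mathbb{R}^d$. Let $\mathbb{P}$ be a compactly supported probability measure on $\mathbb{R}^{d+1}$, $\mathbb{P}_n$ the empirical measure of $n$ i.i.d. draws from $\mathbb{P}$, and $$C=\left(180\sqrt{d+2}+\sqrt{2\log(1/\alpha)}\right)\operatorname{diam}(\operatorname{supp}(\mathbb{P}))^r,\qquad c_{\rho,d}=\max\{1/c_d,1\},$$ with the diameter measured in $\|\cdot\|_*$. Let $\boldsymbol\beta_1=\boldsymbol\beta_1(\mathbb{P}_n)$ and $\boldsymbol\beta_2=\boldsymbol\beta_2(\mathbb{P}_n)$ be two estimators with values in $\mathbb{R}^d$, and let $B$ be a set of probability measures on $\mathbb{R}^{d+1}$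 such that (i) $B\subseteq B_\delta(\mathbb{P})$; (ii) for $j=1,2$, the supremum $\sup_{\mathbb{Q}\in B}\mathbb{E}_{\mathbb{Q}}[|Y-\mathbf{X}^\top\boldsymbol\beta_j|^r]^{1/r}$ is achieved for $\mathbb{P}^*_{\boldsymbol\beta_j}$. Let $$T_n=n^{1/(2r)}\left(\frac{\mathbb{E}_{\mathbb{P}_n}[|Y-\mathbf{X}^\top\boldsymbol\beta_1|^r]^{1/r}-\mathbb{E}_{\mathbb{P}_n}[|Y-\mathbf{X}^\top\boldsymbol\beta_2|^r]^{1/r}+\delta\rho(\boldsymbol\beta_1)-\delta\rho(\boldsymbol\beta_2)}{2\sigma+\rho(\boldsymbol\beta_1)+\rho(\boldsymbol\beta_2)}\right).$$ Then, for any $\boldsymbol\beta_1$ and $\boldsymbol\beta_2$ satisfying $$\sup_{\mathbb{Q}\in B}\mathbb{E}_{\mathbb{Q}}\left[|Y-\mathbf{X}^\top\boldsymbol\beta_1|^r\right]^{1/r}\le\sup_{\mathbb{Q}\in B}\mathbb{E}_{\mathbb{Q}}\left[|Y-\mathbf{X}^\top\boldsymbol\beta_2|^r\right]^{1/r},$$ we have $\operatorname{Prob}\left(T_n>c_{\rho,d}\,C^{1/r}\right)\le\alpha$.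
   Context: Points of $\mathbb{R}^{d+1}$ are written $(\mathbf{x},y)$ with $\mathbf{x}\in\mathbb{R}^d$, $y\in\mathbb{R}$; $\mathbb{E}_{\mathbb{Q}}$ denotes expectation over $(\mathbf{X},Y)\sim\mathbb{Q}$ with $\boldsymbol\beta_1,\boldsymbol\beta_2$ held fixed. $\operatorname{Prob}$ is probability with respect to the sample. The dual norm is $\|\mathbf{x}\|_*=\sup_{\|\mathbf{y}\|=1}\mathbf{x}^\top\mathbf{y}$, and $\operatorname{diam}(\operatorname{supp}(\mathbb{P}))=\sup\{\|\mathbf{z}-\tilde{\mathbf{z}}\|_*:\mathbf{z},\tilde{\mathbf{z}}\in\operatorname{supp}(\mathbb{P})\}$. $\Pi(\mathbb{P},\widetilde{\mathbb{P}})$ is the set of couplings, i.e. joint laws of $((\mathbf{X},Y),(\widetilde{\mathbf{X}},\widetilde{Y}))$ with marginals $\mathbb{P}$ and $\widetilde{\mathbb{P}}$. The $\rho$-max-sliced Wasserstein distance is $$\widehat{\mathcal{W}}_{r,\rho,\sigma}(\mathbb{P},\widetilde{\mathbb{P}})=\sup_{\boldsymbol\gamma\in\mathbb{R}^d}\ \inf_{\pi\in\Pi(\mathbb{P},\widetilde{\mathbb{P}})}\frac{1}{\sigma+\rho(\boldsymbol\gamma)}\left(\mathbb{E}_\pi\left[\left|(Y-\mathbf{X}^\top\boldsymbol\gamma)-(\widetilde{Y}-\widetilde{\mathbf{X}}^\top\boldsymbol\gamma)\right|^r\right]\right)^{1/r},$$ and $B_\delta(\mathbb{P})$ is the set of Borel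 probability measures $\mathbb{Q}$ on $\mathbb{R}^{d+1}$ with finite $r$-th moment and $\widehat{\mathcal{W}}_{r,\rho,\sigma}(\mathbb{Q},\mathbb{P})\le\delta$. $\rho^*(\mathbf{b})=\sup_{\mathbf{x}\in\mathbb{R}^d}\{\mathbf{b}^\top\mathbf{x}-\rho(\mathbf{x})\}$ is the convex conjugate and $\partial\rho(\boldsymbol\beta)=\{\mathbf{b}:\rho(\mathbf{x})\ge\rho(\boldsymbol\beta)+\mathbf{b}^\top(\mathbf{x}-\boldsymbol\beta)\ \forall\mathbf{x}\in\mathbb{R}^d\}$ the subdifferential of $\rho$ at $\boldsymbol\beta$. For $\boldsymbol\beta\in\mathbb{R}^d$, $\mathbb{P}^*_{\boldsymbol\beta}$ is the law of $(\widetilde{\mathbf{X}},\widetilde{Y})$ where $\widetilde{\mathbf{X}}=\mathbf{X}-e\left(\boldsymbol\beta^*-\frac{\boldsymbol\beta}{\boldsymbol\beta^\top\boldsymbol\beta}\rho^*(\boldsymbol\beta^* )\right)$, $\widetilde{Y}=Y+\sigma e$, $e=\delta(Y-\mathbf{X}^\top\boldsymbol\beta)/\left(\mathbb{E}_{\mathbb{P}}[|Y-\mathbf{X}^\top\boldsymbol\beta|^r]\right)^{1/r}$, $(\mathbf{X},Y)\sim\mathbb{P}$, and $\boldsymbol\beta^*\in\partial\rho(\boldsymbol\beta)$ is a subgradient satisfying $(\ast)$. *)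

theory Defs
  imports "HOL-Probability.Probability"
begin

text \<open>Points of $R^{d+1}$ are pairs \<open>(x, y)\<close> of type \<open>(real^'d) \<times> real\<close>. The inner product of the
  product type is the usual one, \<open>(x, y) \<bullet> (x', y') = x \<bullet> x' + y * y'\<close>.\<close>

type_synonym 'd point = "(real^'d) \<times> real"

section \<open>Norms, duals, supports\<close>

definition is_norm :: "('a::real_vector \<Rightarrow> real) \<Rightarrow> bool" where
  "is_norm N \<longleftrightarrow>
     (\<forall>x. 0 \<le> N x) \<and> (\<forall>x. N x = 0 \<longleftrightarrow> x = 0) \<and>
     (\<forall>a x. N (a *\<^sub>R x) = \<bar>a\<bar> * N x) \<and> (\<forall>x y. N (x + y) \<le> N x + N y)"

definition dual_norm :: "('a::euclidean_space \<Rightarrow> real) \<Rightarrow> 'a \<Rightarrow> real" where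
  "dual_norm N x = (SUP y\<in>{y. N y = 1}. x \<bullet> y)"

definition supp :: "'a::topological_space measure \<Rightarrow> 'a set" where
  "supp P = {z. \<forall>U. open U \<longrightarrow> z \<in> U \<longrightarrow> 0 < emeasure P U}"

definition diam :: "('a::euclidean_space \<Rightarrow> real) \<Rightarrow> 'a set \<Rightarrow> real" where
  "diam N S = (SUP (z, z')\<in>S \<times> S. N (z - z'))"

section \<open>Regression risk and the max-sliced Wasserstein ball\<close>

definition resid :: "real^'d \<Rightarrow> 'd point \<Rightarrow> real" where
  "resid \<gamma> z = snd z - fst z \<bullet> \<gamma>"

definition risk :: "real \<Rightarrow> 'd point measure \<Rightarrow> real^'d \<Rightarrow> real" where
  "risk r Q \<beta> = (\<integral>z. \<bar>resid \<beta> z\<bar> powr r \<partial>Q) powr (1 / r)"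

definition couplings :: "'a::topological_space measure \<Rightarrow> 'a measure \<Rightarrow> ('a \<times> 'a) measure set" where
  "couplings P Q = {\<pi>. prob_space \<pi> \<and> sets \<pi> = sets (borel \<Otimes>\<^sub>M borel) \<and>
     distr \<pi> borel fst = P \<and> distr \<pi> borel snd = Q}"

text \<open>The real power, extended by \<open>\<infinity> powr a = \<infinity>\<close> (used for \<open>a > 0\<close> only).\<close>

definition ennreal_powr :: "ennreal \<Rightarrow> real \<Rightarrow> ennreal" where
  "ennreal_powr x a = (if x = \<infinity> then \<infinity> else ennreal (enn2real x powr a))"

definition max_sliced_wasserstein ::
    "real \<Rightarrow> (real^'d \<Rightarrow> real) \<Rightarrow> real \<Rightarrow> 'd point measure \<Rightarrow> 'd point measure \<Rightarrow> ennreal" where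
  "max_sliced_wasserstein r \<rho> \<sigma> P Q =
     (SUP \<gamma>. INF \<pi>\<in>couplings P Q.
        ennreal (1 / (\<sigma> + \<rho> \<gamma>)) *
        ennreal_powr (\<integral>\<^sup>+ w. ennreal (\<bar>resid \<gamma> (fst w) - resid \<gamma> (snd w)\<bar> powr r) \<partial>\<pi>) (1 / r))"

definition wasserstein_ball ::
    "real \<Rightarrow> (real^'d \<Rightarrow> real) \<Rightarrow> real \<Rightarrow> real \<Rightarrow> 'd point measure \<Rightarrow> 'd point measure set" where
  "wasserstein_ball r \<rho> \<sigma> \<delta> P =
     {Q. prob_space Q \<and> sets Q = sets borel \<and> integrable Q (\<lambda>z. norm z powr r) \<and>
         max_sliced_wasserstein r \<rho> \<sigma> Q P \<le> ennreal \<delta>}"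

text \<open>The supremum is taken in the extended reals, so that no boundedness is presupposed.\<close>

definition worst_case_risk :: "real \<Rightarrow> 'd point measure set \<Rightarrow> real^'d \<Rightarrow> ereal" where
  "worst_case_risk r B \<beta> = (SUP Q\<in>B. ereal (risk r Q \<beta>))"

section \<open>Subgradients and the worst-case law\<close>

definition convex_conjugate :: "('a::real_inner \<Rightarrow> real) \<Rightarrow> 'a \<Rightarrow> ereal" where
  "convex_conjugate \<rho> b = (SUP x. ereal (b \<bullet> x - \<rho> x))"

definition subdifferential :: "('a::real_inner \<Rightarrow> real) \<Rightarrow> 'a \<Rightarrow> 'a set" where
  "subdifferential \<rho> \<beta> = {b. \<forall>x. \<rho> x \<ge> \<rho> \<beta> + b \<bullet> (x - \<beta>)}"

text \<open>The vector \<open>b - (\<beta> / (\<beta> \<bullet> \<beta>)) \<rho>\<^sup>*(b)\<close>. It is used for \<open>b \<in> subdifferential \<rho> \<beta>\<close> only, where the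
  conjugate is finite (it equals \<open>b \<bullet> \<beta> - \<rho> \<beta>\<close>). For \<open>\<beta> = 0\<close> the second summand is \<open>0\<close> by the
  convention \<open>x / 0 = 0\<close>. That convention is immaterial: the inequality in \<open>admissible_subgradients\<close>
  at all \<open>\<beta> \<noteq> 0\<close> forces a convex \<open>\<rho>\<close> to be a seminorm, so that \<open>\<rho>\<^sup>*(b) = 0\<close> for every subgradient \<open>b\<close>
  and the inequality at \<open>\<beta> = 0\<close> holds automatically.\<close>

definition shift_direction :: "(real^'d \<Rightarrow> real) \<Rightarrow> real^'d \<Rightarrow> real^'d \<Rightarrow> real^'d" where
  "shift_direction \<rho> \<beta> b = b - (real_of_ereal (convex_conjugate \<rho> b) / (\<beta> \<bullet> \<beta>)) *\<^sub>R \<beta>"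

definition admissible_subgradients :: "(real^'d \<Rightarrow> real) \<Rightarrow> real^'d \<Rightarrow> (real^'d) set" where
  "admissible_subgradients \<rho> \<beta> =
     {b \<in> subdifferential \<rho> \<beta>. \<forall>\<gamma>. \<bar>\<gamma> \<bullet> shift_direction \<rho> \<beta> b\<bar> \<le> \<rho> \<gamma>}"

text \<open>The law of the perturbed pair; meaningful only if \<open>risk r P \<beta> > 0\<close>, because \<open>e\<close> is a quotient by
  that quantity.\<close>

definition worst_case_law ::
    "real \<Rightarrow> (real^'d \<Rightarrow> real) \<Rightarrow> real \<Rightarrow> real \<Rightarrow> 'd point measure \<Rightarrow> real^'d \<Rightarrow> real^'d \<Rightarrow> 'd point measure"
  where
  "worst_case_law r \<rho> \<sigma> \<delta> P \<beta> b =
     distr P borel (\<lambda>z. let e = \<delta> * resid \<beta> z / risk r P \<beta> in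
       (fst z - e *\<^sub>R shift_direction \<rho> \<beta> b, snd z + \<sigma> * e))"

text \<open>The supremum of the risk of \<open>\<beta>\<close> over \<open>B\<close> is achieved at the worst-case law of \<open>\<beta>\<close>, for some
  choice of subgradient in its construction. The first conjunct says that this law is well defined; it
  cannot be dropped, since \<open>0 / 0 = 0\<close> would make the worst-case law of a perfect fit equal to \<open>P\<close>, with
  risk \<open>0\<close> in place of \<open>\<delta> * (\<sigma> + \<rho> \<beta>)\<close>.\<close>

definition sup_achieved_at_worst_case_law ::
    "real \<Rightarrow> (real^'d \<Rightarrow> real) \<Rightarrow> real \<Rightarrow> real \<Rightarrow> 'd point measure \<Rightarrow> 'd point measure set \<Rightarrow> real^'d \<Rightarrow> bool"
  where
  "sup_achieved_at_worst_case_law r \<rho> \<sigma> \<delta> P B \<beta> \<longleftrightarrow>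
     0 < risk r P \<beta> \<and>
     (\<exists>b\<in>admissible_subgradients \<rho> \<beta>.
        worst_case_law r \<rho> \<sigma> \<delta> P \<beta> b \<in> B \<and>
        worst_case_risk r B \<beta> = ereal (risk r (worst_case_law r \<rho> \<sigma> \<delta> P \<beta> b) \<beta>))"

section \<open>Empirical measure and test statistic\<close>

definition empirical_measure :: "nat \<Rightarrow> (nat \<Rightarrow> 'a::topological_space) \<Rightarrow> 'a measure" where
  "empirical_measure n z = distr (uniform_count_measure {..<n}) borel z"

definition test_statistic ::
    "real \<Rightarrow> (real^'d \<Rightarrow> real) \<Rightarrow> real \<Rightarrow> real \<Rightarrow> nat \<Rightarrow> 'd point measure \<Rightarrow> real^'d \<Rightarrow> real^'d \<Rightarrow> real" where
  "test_statistic r \<rho> \<sigma> \<delta> n Pn \<beta>1 \<beta>2 =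
     real n powr (1 / (2 * r)) *
     ((risk r Pn \<beta>1 - risk r Pn \<beta>2 + \<delta> * \<rho> \<beta>1 - \<delta> * \<rho> \<beta>2) / (2 * \<sigma> + \<rho> \<beta>1 + \<rho> \<beta>2))"

end

theory Submission
  imports Defs
begin

text \<open>
  The theorem is true because the worst-case risk of an estimator is its risk plus a penalty, which
  turns the comparison of worst-case risks into a comparison of penalized risks, and because empirical
  and true risks are close simultaneously for all coefficient vectors.

  \<^item> The condition on the subgradients makes \<open>\<rho>\<close> vanish at \<open>0\<close> (\<open>admissible_penalty_zero\<close>) and makes the
  worst-case law multiply each residual of \<open>\<beta>\<close> by the same factor
  \<open>1 + \<delta> (\<sigma> + \<rho> \<beta>) / risk r P \<beta>\<close>. The supremum of the risk is therefore
  \<open>risk r P \<beta> + \<delta> (\<sigma> + \<rho> \<beta>)\<close> (\<open>worst_case_risk_eq\<close>). So the hypothesis on the two estimators bounds the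
  numerator of the statistic by \<open>risk r Pn \<beta>1 - risk r P \<beta>1\<close> plus \<open>risk r P \<beta>2 - risk r Pn \<beta>2\<close>, and it
  remains to bound \<open>\<bar>risk r Pn \<gamma> - risk r P \<gamma>\<bar> / (\<sigma> + \<rho> \<gamma>)\<close> uniformly in \<open>\<gamma>\<close> (\<open>test_statistic_le\<close>).

  \<^item> For laws on an interval of length \<open>D\<close>, the distance of the \<open>L\<^sup>r\<close> norms is at most the \<open>r\<close>-Wasserstein
  distance \<open>W\<^sub>r\<close>, and \<open>W\<^sub>r\<^sup>r \<le> D\<^sup>r\<^sup>-\<^sup>1 W\<^sub>1\<close>. The lemma \<open>Lr_norm_le_of_lipschitz_integrals\<close> proves the
  resulting inequality in dual form: it suffices to compare integrals of Lipschitz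
  functions of the residual. Going through Lipschitz test functions, and not through \<open>\<bar>x\<bar>\<^sup>r\<close> itself, is
  what keeps the constants free of \<open>r\<close>.

  \<^item> Up to additive constants, the functions \<open>z \<mapsto> h (u \<bullet> z)\<close> with \<open>h\<close> 1-Lipschitz and \<open>u\<close> in the unit
  ball have finite nets in the supremum norm on a support of diameter at most \<open>1\<close>, of size \<open>exp (O (dimension / \<epsilon>))\<close> at scale \<open>\<epsilon>\<close> (\<open>ridge_function_net\<close>). Since
  this entropy is \<open>O (1 / \<epsilon>)\<close>, its square root is integrable at \<open>0\<close> and chaining gives deviations of order
  \<open>1 / sqrt n\<close> without a logarithm. The nets are deterministic, so Hoeffding's inequality and a union
  bound over finitely many links of the chain suffice (\<open>chaining_bound\<close>). The outcome is
  \<open>lipschitz_projection_concentration\<close>.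

  The condition on \<open>c\<^sub>d\<close> enters at the end, to bound the scale \<open>N (\<gamma>, -1)\<close> of the residual by
  \<open>(\<sigma> + \<rho> \<gamma>) / c\<^sub>d\<close>.
\<close>

section \<open>Norms and dual norms\<close>

lemma is_normD:
  assumes "is_norm N"
  shows "0 \<le> N x" "N x = 0 \<longleftrightarrow> x = 0" "N (a *\<^sub>R x) = \<bar>a\<bar> * N x" "N (x + y) \<le> N x + N y"
    "N 0 = 0" "N (- x) = N x" "N (x - y) = N (y - x)"
proof -
  show *: "0 \<le> N x" "N x = 0 \<longleftrightarrow> x = 0" "N (a *\<^sub>R x) = \<bar>a\<bar> * N x" "N (x + y) \<le> N x + N y" for x y a
    using assms by (auto simp: is_norm_def)
  show "N 0 = 0" using *(2)[of 0] by simp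
  show m: "N (- x) = N x" for x using *(3)[of "-1" x] by simp
  show "N (x - y) = N (y - x)" using m[of "x - y"] by simp
qed

lemma is_norm_diff_le:
  assumes "is_norm N"
  shows "\<bar>N x - N y\<bar> \<le> N (x - y)"
  using is_normD(4)[OF assms, of "x - y" y] is_normD(4)[OF assms, of "y - x" x]
    is_normD(7)[OF assms, of x y] by simp

lemma is_norm_le_norm:
  fixes N :: "'a::euclidean_space \<Rightarrow> real"
  assumes "is_norm N"
  shows "N x \<le> (\<Sum>b\<in>Basis. N b) * norm x"
proof -
  have sum_le: "N (\<Sum>b\<in>A. f b) \<le> (\<Sum>b\<in>A. N (f b))" if "finite A" for A :: "'a set" and f
    using that
    by (induction A rule: finite_induct)
       (auto simp: is_normD(5)[OF assms] intro: order_trans[OF is_normD(4)[OF assms]])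
  have "N x = N (\<Sum>b\<in>Basis. (x \<bullet> b) *\<^sub>R b)" by (simp add: euclidean_representation)
  also have "\<dots> \<le> (\<Sum>b\<in>Basis. N ((x \<bullet> b) *\<^sub>R b))" by (intro sum_le) simp
  also have "\<dots> = (\<Sum>b\<in>Basis. \<bar>x \<bullet> b\<bar> * N b)" by (simp add: is_normD(3)[OF assms])
  also have "\<dots> \<le> (\<Sum>b\<in>Basis. norm x * N b)"
    by (intro sum_mono mult_right_mono Basis_le_norm is_normD(1)[OF assms])
  finally show ?thesis by (simp add: sum_distrib_left mult.commute)
qed

lemma continuous_on_is_norm:
  fixes N :: "'a::euclidean_space \<Rightarrow> real"
  assumes "is_norm N"
  shows "continuous_on S N"
proof -
  have "(\<Sum>b\<in>Basis. N b)-lipschitz_on S N"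
  proof (rule lipschitz_onI)
    show "dist (N x) (N y) \<le> (\<Sum>b\<in>Basis. N b) * dist x y" for x y
      using is_norm_diff_le[OF assms, of x y] is_norm_le_norm[OF assms, of "x - y"]
      by (simp add: dist_norm)
    show "0 \<le> (\<Sum>b\<in>Basis. N b)" by (intro sum_nonneg is_normD(1)[OF assms])
  qed
  then show ?thesis by (rule lipschitz_on_continuous_on)
qed

lemma norm_le_is_norm:
  fixes N :: "'a::euclidean_space \<Rightarrow> real"
  assumes "is_norm N"
  obtains c where "c > 0" "\<And>x. c * norm x \<le> N x"
proof -
  have "\<exists>x\<in>sphere (0::'a) 1. \<forall>y\<in>sphere 0 1. N x \<le> N y"
    by (rule continuous_attains_inf) (auto intro: continuous_on_is_norm[OF assms])
  then obtain x where x: "norm x = 1" "\<And>y. norm y = 1 \<Longrightarrow> N x \<le> N y" by auto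
  have "N x \<noteq> 0" using x(1) is_normD(2)[OF assms, of x] by auto
  then have "N x > 0" using is_normD(1)[OF assms, of x] by simp
  moreover have "N x * norm y \<le> N y" for y
  proof (cases "y = 0")
    case False
    then have "N x \<le> N ((1 / norm y) *\<^sub>R y)" by (intro x(2)) simp
    then show ?thesis using False by (simp add: is_normD(3)[OF assms] field_simps)
  qed (simp add: is_normD(5)[OF assms])
  ultimately show ?thesis by (rule that)
qed

lemma dual_norm_bdd_above:
  fixes N :: "'a::euclidean_space \<Rightarrow> real"
  assumes "is_norm N"
  obtains K where "K \<ge> 0" "\<And>x y. N y = 1 \<Longrightarrow> x \<bullet> y \<le> K * norm x"
proof -
  obtain c where c: "c > 0" "\<And>x. c * norm x \<le> N x" using norm_le_is_norm[OF assms] by blast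
  have "x \<bullet> y \<le> (1 / c) * norm x" if "N y = 1" for x y
  proof -
    have "norm y \<le> 1 / c" using c(1) c(2)[of y] that by (simp add: field_simps)
    then have "norm x * norm y \<le> norm x * (1 / c)" by (intro mult_left_mono) auto
    then show ?thesis using norm_cauchy_schwarz[of x y] by (simp add: mult.commute)
  qed
  then show ?thesis using that[of "1 / c"] c(1) by simp
qed

text \<open>
  Hoelder's inequality for a dual pair of norms. The supremum that defines the dual norm is a real
  supremum, so the proof needs the boundedness that the previous lemma provides.
\<close>

lemma inner_le_dual_norm:
  fixes N :: "'a::euclidean_space \<Rightarrow> real"
  assumes "is_norm N"
  shows "\<bar>u \<bullet> x\<bar> \<le> N u * dual_norm N x"
proof -
  obtain K where K: "K \<ge> 0" "\<And>x y. N y = 1 \<Longrightarrow> x \<bullet> y \<le> K * norm x"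
    using dual_norm_bdd_above[OF assms] by blast
  have *: "x \<bullet> y \<le> N y * dual_norm N x" if "y \<noteq> 0" for y
  proof -
    have pos: "N y > 0" using that is_normD(1,2)[OF assms, of y] by (simp add: order_less_le)
    have "x \<bullet> ((1 / N y) *\<^sub>R y) \<le> dual_norm N x"
      unfolding dual_norm_def
    proof (rule cSUP_upper)
      show "(1 / N y) *\<^sub>R y \<in> {y. N y = 1}" using pos by (simp add: is_normD(3)[OF assms])
      show "bdd_above ((\<bullet>) x ` {y. N y = 1})" by (rule bdd_aboveI2[where M="K * norm x"]) (use K in auto)
    qed
    then show ?thesis using pos by (simp add: field_simps)
  qed
  show ?thesis
  proof (cases "u = 0")
    case False
    then show ?thesis using *[of u] *[of "- u"]
      by (simp add: is_normD(6)[OF assms] inner_commute abs_le_iff)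
  qed (simp add: is_normD(5)[OF assms])
qed

lemma dual_norm_le_diam:
  fixes N :: "'a::euclidean_space \<Rightarrow> real"
  assumes "is_norm N" "compact S" "z \<in> S" "z' \<in> S"
  shows "dual_norm N (z - z') \<le> diam (dual_norm N) S"
proof -
  obtain K where K: "K \<ge> 0" "\<And>x y. N y = 1 \<Longrightarrow> x \<bullet> y \<le> K * norm x"
    using dual_norm_bdd_above[OF assms(1)] by blast
  obtain b :: 'a where b: "b \<in> Basis" using nonempty_Basis by blast
  then have "N b > 0" using is_normD(1,2)[OF assms(1), of b] nonzero_Basis[of b] by (simp add: order_less_le)
  then have ne: "{y. N y = 1} \<noteq> {}"
    using is_normD(3)[OF assms(1), of "1 / N b" b] by auto
  have le: "dual_norm N x \<le> K * norm x" for x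
    unfolding dual_norm_def by (rule cSUP_least) (use ne K in auto)
  obtain R where R: "\<And>x. x \<in> S \<Longrightarrow> norm x \<le> R"
    using compact_imp_bounded[OF assms(2)] by (auto simp: bounded_iff)
  have "bdd_above ((\<lambda>(z, z'). dual_norm N (z - z')) ` (S \<times> S))"
  proof (rule bdd_aboveI2[where M="K * (R + R)"])
    fix p assume p: "p \<in> S \<times> S"
    have "norm (fst p - snd p) \<le> R + R"
      using R[of "fst p"] R[of "snd p"] p norm_triangle_ineq4[of "fst p" "snd p"] by auto
    then show "(\<lambda>(z, z'). dual_norm N (z - z')) p \<le> K * (R + R)"
      using le[of "fst p - snd p"] mult_left_mono[of "norm (fst p - snd p)" "R + R" K] K(1)
      by (auto simp: case_prod_unfold)
  qed
  from cSUP_upper[OF _ this, of "(z, z')"] show ?thesis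
    using assms by (simp add: diam_def)
qed

section \<open>Finite nets for ridge functions\<close>

text \<open>
  The volume argument: balls of radius \<open>1/q\<close> around the points of a \<open>2/q\<close>-separated subset of the unit ball
  are disjoint and lie in the ball of radius \<open>1 + 1/q\<close>, so their number is at most the ratio
  \<open>(1 + q) ^ DIM('a)\<close> of the volumes.
\<close>

lemma norm_ball_separated_card_le:
  fixes N :: "'a::euclidean_space \<Rightarrow> real"
  assumes N: "is_norm N" and q: "q > 0" and fin: "finite U" and U: "\<And>u. u \<in> U \<Longrightarrow> N u \<le> 1"
    and sep: "\<And>u v. u \<in> U \<Longrightarrow> v \<in> U \<Longrightarrow> u \<noteq> v \<Longrightarrow> N (u - v) > 2 / real q"
  shows "card U \<le> (1 + q) ^ DIM('a)"
proof -
  define V where "V = {x. N x < 1}"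
  define T where "T = (\<lambda>m (t::'a). (\<lambda>x. m *\<^sub>R x + t) ` V)"
  have V_open: "open V"
    unfolding V_def by (intro open_Collect_less continuous_on_is_norm[OF N] continuous_on_const)
  obtain c where c: "c > 0" "\<And>x. c * norm x \<le> N x" using norm_le_is_norm[OF N] by blast
  have "V \<subseteq> cball 0 (1 / c)"
  proof
    fix x assume "x \<in> V"
    then show "x \<in> cball 0 (1 / c)" using c(1) c(2)[of x] by (simp add: V_def field_simps)
  qed
  then have V_bdd: "bounded V" using bounded_cball bounded_subset by blast
  have V_meas: "V \<in> lmeasurable" by (rule lmeasurable_open[OF V_bdd V_open])
  have "0 \<in> V" by (simp add: V_def is_normD(5)[OF N])
  then have "measure lebesgue V \<noteq> 0"
    using open_not_negligible[OF V_open] negligible_iff_measure0[OF V_meas] by blast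
  then have V_pos: "measure lebesgue V > 0" using measure_nonneg[of lebesgue V] by linarith
  have T_iff: "x \<in> T m t \<longleftrightarrow> N (x - t) < m" if "m > 0" for x m t
  proof
    assume "x \<in> T m t"
    then obtain y where "x = m *\<^sub>R y + t" "N y < 1" by (auto simp: T_def V_def)
    then show "N (x - t) < m" using that by (simp add: is_normD(3)[OF N])
  next
    assume "N (x - t) < m"
    then have "(1 / m) *\<^sub>R (x - t) \<in> V" using that by (simp add: V_def is_normD(3)[OF N])
    moreover have "x = m *\<^sub>R ((1 / m) *\<^sub>R (x - t)) + t" using that by simp
    ultimately show "x \<in> T m t" unfolding T_def by (rule rev_image_eqI)
  qed
  have T_meas: "T m t \<in> lmeasurable" if "m > 0" for m t
  proof -
    have "T m t = {x. N (x - t) < m}" using T_iff[OF that] by auto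
    moreover have "open {x. N (x - t) < m}"
      by (intro open_Collect_less continuous_on_const
            continuous_on_compose2[OF continuous_on_is_norm[OF N, of UNIV]] continuous_intros) auto
    moreover have "bounded (T m t)"
    proof -
      have "T m t = (+) t ` ((\<lambda>x. m *\<^sub>R x) ` V)" by (auto simp: T_def image_image)
      then show ?thesis using V_bdd by (simp add: bounded_translation bounded_scaling)
    qed
    ultimately show ?thesis using lmeasurable_open by metis
  qed
  have T_measure: "measure lebesgue (T m t) = m ^ DIM('a) * measure lebesgue V" if "m > 0" for m t
    using that unfolding T_def by (simp add: measure_lebesgue_affine)
  define e where "e = 1 / real q"
  have e: "e > 0" using q by (simp add: e_def)
  have disj: "pairwise (\<lambda>u v. disjnt (T e u) (T e v)) U"
  proof (rule pairwiseI)
    fix u v assume uv: "u \<in> U" "v \<in> U" "u \<noteq> v"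
    have False if "x \<in> T e u" "x \<in> T e v" for x
    proof -
      have "N (u - v) \<le> N (u - x) + N (x - v)" using is_normD(4)[OF N, of "u - x" "x - v"] by simp
      also have "\<dots> < 2 * e" using that by (simp add: T_iff[OF e] is_normD(7)[OF N, of u x])
      finally show False using sep[OF uv] by (simp add: e_def)
    qed
    then show "disjnt (T e u) (T e v)" by (auto simp: disjnt_iff)
  qed
  have "real (card U) * (e ^ DIM('a) * measure lebesgue V) = (\<Sum>u\<in>U. measure lebesgue (T e u))"
    by (simp add: T_measure[OF e])
  also have "\<dots> = measure lebesgue (\<Union>u\<in>U. T e u)"
    by (rule measure_UNION'[symmetric]) (use fin T_meas[OF e] disj in auto)
  also have "\<dots> \<le> measure lebesgue (T (1 + e) 0)"
  proof (rule measure_mono_fmeasurable)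
    show "(\<Union>u\<in>U. T e u) \<subseteq> T (1 + e) 0"
    proof
      fix x assume "x \<in> (\<Union>u\<in>U. T e u)"
      then obtain u where u: "u \<in> U" "N (x - u) < e" by (auto simp: T_iff[OF e])
      then have "N x < 1 + e" using is_normD(4)[OF N, of "x - u" u] U[of u] by simp
      then show "x \<in> T (1 + e) 0" using e by (simp add: T_iff)
    qed
    show "(\<Union>u\<in>U. T e u) \<in> sets lebesgue"
      using fin T_meas[OF e] by (intro sets.finite_UN) auto
    show "T (1 + e) 0 \<in> lmeasurable" using e by (intro T_meas) simp
  qed
  also have "\<dots> = (1 + e) ^ DIM('a) * measure lebesgue V" using e by (intro T_measure) simp
  finally have "real (card U) * e ^ DIM('a) \<le> (1 + e) ^ DIM('a)" using V_pos by simp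
  then have "real (card U) \<le> ((1 + e) / e) ^ DIM('a)"
    using e by (simp add: power_divide field_simps)
  also have "(1 + e) / e = real (1 + q)" using q by (simp add: e_def field_simps)
  finally show ?thesis by (simp only: of_nat_power[symmetric] of_nat_le_iff)
qed

text \<open>
  A separated set of largest possible cardinality is a net, since any point far from it could be added.
\<close>

lemma norm_ball_net:
  fixes N :: "'a::euclidean_space \<Rightarrow> real"
  assumes N: "is_norm N" and q: "q > 0"
  obtains U where "finite U" "card U \<le> (1 + q) ^ DIM('a)" "\<And>u. u \<in> U \<Longrightarrow> N u \<le> 1"
    "\<And>u. N u \<le> 1 \<Longrightarrow> \<exists>v\<in>U. N (u - v) \<le> 2 / real q"
proof -
  define separated where "separated U \<longleftrightarrow> finite U \<and> (\<forall>u\<in>U. N u \<le> 1) \<and>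
    (\<forall>u\<in>U. \<forall>v\<in>U. u \<noteq> v \<longrightarrow> N (u - v) > 2 / real q)" for U
  have le: "card U \<le> (1 + q) ^ DIM('a)" if "separated U" for U
    using that by (intro norm_ball_separated_card_le[OF N q]) (auto simp: separated_def)
  have "separated {}" by (simp add: separated_def)
  then obtain U where U: "separated U" and mx: "\<And>W. separated W \<Longrightarrow> card W \<le> card U"
    using ex_has_greatest_nat[of separated "{}" card "Suc ((1 + q) ^ DIM('a))"] le
    by (auto simp: less_Suc_eq_le)
  have "\<exists>v\<in>U. N (u - v) \<le> 2 / real q" if u: "N u \<le> 1" for u
  proof (rule ccontr)
    assume "\<not> ?thesis"
    then have far: "\<And>v. v \<in> U \<Longrightarrow> N (u - v) > 2 / real q" by (auto simp: not_le)
    then have "u \<notin> U" using is_normD(5)[OF N] q by fastforce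
    moreover have "separated (insert u U)"
      using U u far by (auto simp: separated_def is_normD(7)[OF N, of _ u])
    ultimately show False using mx[of "insert u U"] U by (simp add: separated_def)
  qed
  then show ?thesis using that U le by (auto simp: separated_def)
qed

text \<open>
  Round the values of \<open>h\<close> on a grid of mesh \<open>2/q\<close> down to multiples of the mesh. Because \<open>h\<close> is
  1-Lipschitz, consecutive rounded values differ by \<open>-1\<close>, \<open>0\<close> or \<open>1\<close> mesh units, and because
  \<open>h (-1) = 0\<close> these \<open>q\<close> increments determine them all. Half of the error \<open>4/q\<close> comes from the rounding
  and half from replacing the argument by a grid point.
\<close>

lemma lipschitz_step_net:
  assumes q: "q > 0"
  obtains H :: "(real \<Rightarrow> real) set" where "finite H" "card H \<le> 3 ^ q"
    "\<And>a. a \<in> H \<Longrightarrow> a \<in> borel_measurable borel"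
    "\<And>h. 1-lipschitz_on UNIV h \<Longrightarrow> h (-1) = 0 \<Longrightarrow> \<exists>a\<in>H. \<forall>x\<in>{-1..1}. \<bar>h x - a x\<bar> \<le> 4 / real q"
proof -
  define e where "e = 2 / real q"
  have e: "e > 0" using q by (simp add: e_def)
  define step :: "(nat \<Rightarrow> int) \<Rightarrow> real \<Rightarrow> real" where
    "step d x = e * of_int (\<Sum>i<nat \<lfloor>(x + 1) / e\<rfloor>. d i)" for d x
  define \<Delta> where "\<Delta> = {..<q} \<rightarrow>\<^sub>E {-1, 0, 1 :: int}"
  have fin: "finite \<Delta>" unfolding \<Delta>_def by (intro finite_PiE) auto
  have card: "card \<Delta> = 3 ^ q" unfolding \<Delta>_def by (simp add: card_PiE numeral_3_eq_3)
  have meas: "step d \<in> borel_measurable borel" for d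
  proof -
    have "(\<lambda>x::real. \<lfloor>(x + 1) / e\<rfloor>) \<in> borel \<rightarrow>\<^sub>M count_space UNIV" by measurable
    moreover have "(\<lambda>k. e * of_int (\<Sum>i<nat k. d i)) \<in> count_space UNIV \<rightarrow>\<^sub>M borel" by simp
    ultimately have "(\<lambda>k. e * of_int (\<Sum>i<nat k. d i)) \<circ> (\<lambda>x. \<lfloor>(x + 1) / e\<rfloor>) \<in> borel_measurable borel"
      by (rule measurable_comp)
    moreover have "step d = (\<lambda>k. e * of_int (\<Sum>i<nat k. d i)) \<circ> (\<lambda>x. \<lfloor>(x + 1) / e\<rfloor>)"
      by (rule ext) (simp add: step_def)
    ultimately show ?thesis by simp
  qed
  have approx: "\<exists>d\<in>\<Delta>. \<forall>x\<in>{-1..1}. \<bar>h x - step d x\<bar> \<le> 4 / real q"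
    if lip: "1-lipschitz_on UNIV h" and h0: "h (-1) = 0" for h :: "real \<Rightarrow> real"
  proof -
    have lip': "\<bar>h x - h y\<bar> \<le> \<bar>x - y\<bar>" for x y
      using lipschitz_onD[OF lip, of x y] by (simp add: dist_real_def)
    define k where "k j = \<lfloor>h (real j * e - 1) / e\<rfloor>" for j :: nat
    have k0: "k 0 = 0" by (simp add: k_def h0)
    define d where "d = restrict (\<lambda>i. k (Suc i) - k i) {..<q}"
    have "k (Suc i) - k i \<in> {-1, 0, 1}" for i
    proof -
      have "\<bar>h (real (Suc i) * e - 1) - h (real i * e - 1)\<bar> \<le> e"
        using lip'[of "real (Suc i) * e - 1" "real i * e - 1"] e by (simp add: algebra_simps)
      then have "\<bar>h (real (Suc i) * e - 1) / e - h (real i * e - 1) / e\<bar> \<le> 1"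
        using e by (simp add: diff_divide_distrib[symmetric] abs_divide)
      then show ?thesis unfolding k_def by simp linarith
    qed
    then have "d \<in> \<Delta>" by (auto simp: d_def \<Delta>_def)
    moreover have "\<bar>h x - step d x\<bar> \<le> 4 / real q" if x: "x \<in> {-1..1}" for x
    proof -
      define j where "j = nat \<lfloor>(x + 1) / e\<rfloor>"
      have j: "real j \<le> (x + 1) / e" "(x + 1) / e < real j + 1"
        using x e unfolding j_def by (auto simp: of_nat_nat)
      have "(x + 1) / e \<le> real q" using x e q by (simp add: e_def field_simps)
      then have "j \<le> q" using j(1) by linarith
      then have "(\<Sum>i<j. d i) = (\<Sum>i<j. k (Suc i) - k i)" by (intro sum.cong) (auto simp: d_def)
      also have "\<dots> = k j" using k0 by (simp add: sum_lessThan_telescope)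
      finally have st: "step d x = e * of_int (k j)" by (simp add: step_def j_def)
      have "of_int (k j) \<le> h (real j * e - 1) / e" "h (real j * e - 1) / e < of_int (k j) + 1"
        unfolding k_def by auto
      then have 1: "\<bar>h (real j * e - 1) - e * of_int (k j)\<bar> \<le> e"
        using e by (simp add: field_simps abs_le_iff)
      have 2: "\<bar>h x - h (real j * e - 1)\<bar> \<le> e"
        using lip'[of x "real j * e - 1"] j e by (simp add: field_simps)
      from 1 2 show ?thesis unfolding st by (simp add: e_def)
    qed
    ultimately show ?thesis by blast
  qed
  show ?thesis
  proof (rule that[of "step ` \<Delta>"])
    show "card (step ` \<Delta>) \<le> 3 ^ q" using card_image_le[OF fin, of step] card by simp
  qed (use fin meas approx in auto)
qed

text \<open>
  Pairs of a net of directions and a net of profiles. The condition \<open>\<bar>v \<bullet> x\<bar> \<le> N v\<close> says that \<open>x\<close> lies in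
  the unit ball of the dual norm; it keeps \<open>v \<bullet> x\<close> in the interval \<open>[-1, 1]\<close> on which the profiles are
  approximated.
\<close>

lemma ridge_function_net:
  fixes N :: "'a::euclidean_space \<Rightarrow> real"
  assumes N: "is_norm N" and q: "q > 0"
  obtains G :: "('a \<Rightarrow> real) set" where "finite G" "real (card G) \<le> exp (real ((DIM('a) + 2) * q))"
    "\<And>a. a \<in> G \<Longrightarrow> a \<in> borel_measurable borel"
    "\<And>u h. N u \<le> 1 \<Longrightarrow> 1-lipschitz_on UNIV h \<Longrightarrow> h (-1) = 0 \<Longrightarrow>
      \<exists>a\<in>G. \<forall>x. (\<forall>v. \<bar>v \<bullet> x\<bar> \<le> N v) \<longrightarrow> \<bar>h (u \<bullet> x) - a x\<bar> \<le> 6 / real q"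
proof -
  obtain U where U: "finite U" "card U \<le> (1 + q) ^ DIM('a)" "\<And>u. u \<in> U \<Longrightarrow> N u \<le> 1"
    "\<And>u. N u \<le> 1 \<Longrightarrow> \<exists>v\<in>U. N (u - v) \<le> 2 / real q"
    using norm_ball_net[OF N q] by blast
  obtain H :: "(real \<Rightarrow> real) set" where H: "finite H" "card H \<le> 3 ^ q" "\<And>a. a \<in> H \<Longrightarrow> a \<in> borel_measurable borel"
    "\<And>h. 1-lipschitz_on UNIV h \<Longrightarrow> h (-1) = 0 \<Longrightarrow> \<exists>a\<in>H. \<forall>x\<in>{-1..1}. \<bar>h x - a x\<bar> \<le> 4 / real q"
    using lipschitz_step_net[OF q] by blast
  define ridge :: "(real \<Rightarrow> real) \<times> 'a \<Rightarrow> 'a \<Rightarrow> real" where "ridge = (\<lambda>(a, v) x. a (v \<bullet> x))"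
  define G where "G = ridge ` (H \<times> U)"
  have fin: "finite G" using U H by (simp add: G_def)
  have "card G \<le> card (H \<times> U)" unfolding G_def using U H by (intro card_image_le) simp
  also have "\<dots> \<le> 3 ^ q * (1 + q) ^ DIM('a)"
    unfolding card_cartesian_product by (intro mult_mono U H) auto
  finally have "real (card G) \<le> real (3 ^ q * (1 + q) ^ DIM('a))" by (rule of_nat_mono)
  also have "\<dots> \<le> exp 2 ^ q * exp (real q) ^ DIM('a)"
  proof -
    have "(3::real) \<le> exp 2" using exp_ge_add_one_self[of 2] by simp
    moreover have "1 + real q \<le> exp (real q)" by (rule exp_ge_add_one_self)
    ultimately have "3 ^ q \<le> exp (2::real) ^ q" "(1 + real q) ^ DIM('a) \<le> exp (real q) ^ DIM('a)"
      by (auto intro: power_mono)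
    then show ?thesis by (simp add: mult_mono)
  qed
  also have "\<dots> = exp (real ((DIM('a) + 2) * q))"
    by (simp add: exp_of_nat_mult[symmetric] exp_add[symmetric] algebra_simps)
  finally have card: "real (card G) \<le> exp (real ((DIM('a) + 2) * q))" .
  have meas: "a \<in> borel_measurable borel" if aG: "a \<in> G" for a
  proof -
    obtain p where p: "p \<in> H \<times> U" "a = ridge p" using aG unfolding G_def by blast
    then have a: "a = (\<lambda>x. fst p (snd p \<bullet> x))" by (simp add: ridge_def case_prod_unfold)
    show ?thesis unfolding a by (rule measurable_compose[OF _ H(3)]) (use p in auto)
  qed
  have net: "\<exists>a\<in>G. \<forall>x. (\<forall>v. \<bar>v \<bullet> x\<bar> \<le> N v) \<longrightarrow> \<bar>h (u \<bullet> x) - a x\<bar> \<le> 6 / real q"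
    if u: "N u \<le> 1" and h: "1-lipschitz_on UNIV h" "h (-1) = 0" for u h
  proof -
    obtain v where v: "v \<in> U" "N (u - v) \<le> 2 / real q" using U(4)[OF u] by blast
    obtain a where a: "a \<in> H" "\<And>x. x \<in> {-1..1} \<Longrightarrow> \<bar>h x - a x\<bar> \<le> 4 / real q" using H(4)[OF h] by blast
    have "\<bar>h (u \<bullet> x) - a (v \<bullet> x)\<bar> \<le> 6 / real q" if x: "\<And>v. \<bar>v \<bullet> x\<bar> \<le> N v" for x
    proof -
      have "\<bar>h (u \<bullet> x) - h (v \<bullet> x)\<bar> \<le> \<bar>u \<bullet> x - v \<bullet> x\<bar>"
        using lipschitz_onD[OF h(1), of "u \<bullet> x" "v \<bullet> x"] by (simp add: dist_real_def)
      also have "\<dots> = \<bar>(u - v) \<bullet> x\<bar>" by (simp add: inner_diff_left)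
      also have "\<dots> \<le> 2 / real q" using x[of "u - v"] v(2) by linarith
      finally have "\<bar>h (u \<bullet> x) - h (v \<bullet> x)\<bar> \<le> 2 / real q" .
      moreover have "\<bar>h (v \<bullet> x) - a (v \<bullet> x)\<bar> \<le> 4 / real q"
        using x[of v] U(3)[OF v(1)] by (intro a(2)) (auto simp: abs_le_iff)
      moreover have "6 / real q = 2 / real q + 4 / real q" by (simp add: add_divide_distrib[symmetric])
      ultimately show ?thesis by linarith
    qed
    then have "\<forall>x. (\<forall>v. \<bar>v \<bullet> x\<bar> \<le> N v) \<longrightarrow> \<bar>h (u \<bullet> x) - a (v \<bullet> x)\<bar> \<le> 6 / real q" by simp
    moreover have "(\<lambda>x. a (v \<bullet> x)) \<in> G"
      unfolding G_def by (rule image_eqI[where x="(a, v)"]) (use a v in \<open>auto simp: ridge_def\<close>)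
    ultimately show ?thesis by (rule bexI[where x="\<lambda>x. a (v \<bullet> x)"])
  qed
  show ?thesis by (rule that[OF fin card meas net])
qed

section \<open>Comparing moments through Lipschitz test functions\<close>

text \<open>
  Convexity of the power \<open>r\<close>, applied to \<open>a + b = t (a / t) + (1 - t) (b / (1 - t))\<close>.
\<close>

lemma powr_add_le_weighted:
  fixes a b r t :: real
  assumes "r \<ge> 1" "0 \<le> a" "0 \<le> b" "0 < t" "t < 1"
  shows "(a + b) powr r \<le> t powr (1 - r) * a powr r + (1 - t) powr (1 - r) * b powr r"
proof -
  have ge1: "1 \<le> s powr (1 - r)" if "0 < s" "s < 1" for s
    using powr_mono'[of "1 - r" 0 s] that assms(1) by simp
  consider "a = 0" | "b = 0" | "a > 0" "b > 0" using assms by linarith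
  then show ?thesis
  proof cases
    case 1
    then show ?thesis using mult_right_mono[OF ge1[of "1 - t"], of "b powr r"] assms by simp
  next
    case 2
    then show ?thesis using mult_right_mono[OF ge1[of t], of "a powr r"] assms by simp
  next
    case 3
    have scale: "s * (c / s) powr r = s powr (1 - r) * c powr r" if "s > 0" "c > 0" for s c
    proof -
      have "s * (c / s) powr r = (s powr 1 / s powr r) * c powr r" using that by (simp add: powr_divide)
      then show ?thesis by (simp only: powr_diff)
    qed
    have "(\<lambda>x. x powr r) ((1 - (1 - t)) *\<^sub>R (a / t) + (1 - t) *\<^sub>R (b / (1 - t)))
        \<le> (1 - (1 - t)) * (a / t) powr r + (1 - t) * (b / (1 - t)) powr r"
      by (rule convex_onD[OF powr_convex[OF assms(1)]]) (use assms 3 in auto)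
    then show ?thesis using assms 3 scale[of t a] scale[of "1 - t" b] by simp
  qed
qed

text \<open>
  The infimum of a family of functions \<open>x \<mapsto> g y + L \<bar>x - y\<bar>\<close> inherits their Lipschitz constant. With
  \<open>L\<close> a multiple of the cost of transport, this is the Kantorovich potential used below.
\<close>

lemma lipschitz_inf_convolution:
  fixes g :: "real \<Rightarrow> real"
  assumes "I \<noteq> {}" "L \<ge> 0" "\<And>y. y \<in> I \<Longrightarrow> 0 \<le> g y"
  shows "L-lipschitz_on UNIV (\<lambda>x. INF y\<in>I. g y + L * \<bar>x - y\<bar>)"
proof (rule lipschitz_onI)
  define h where "h x = (INF y\<in>I. g y + L * \<bar>x - y\<bar>)" for x
  have bdd: "bdd_below ((\<lambda>y. g y + L * \<bar>x - y\<bar>) ` I)" for x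
    by (rule bdd_belowI2[where m=0]) (use assms in auto)
  have "h x - L * \<bar>x - x'\<bar> \<le> h x'" for x x'
    unfolding h_def[of x']
  proof (rule cINF_greatest[OF assms(1)])
    fix y assume y: "y \<in> I"
    have "h x \<le> g y + L * \<bar>x - y\<bar>" unfolding h_def by (rule cINF_lower[OF bdd y])
    also have "\<dots> \<le> g y + L * (\<bar>x - x'\<bar> + \<bar>x' - y\<bar>)" using assms(2) by (intro add_left_mono mult_left_mono) auto
    finally show "h x - L * \<bar>x - x'\<bar> \<le> g y + L * \<bar>x' - y\<bar>" by (simp add: algebra_simps)
  qed
  from this[of x y for x y] this[of y x for x y]
  show "dist (INF y\<in>I. g y + L * \<bar>x - y\<bar>) (INF y\<in>I. g y + L * \<bar>x' - y\<bar>) \<le> L * dist x x'" for x x'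
    unfolding h_def[symmetric] by (simp add: dist_real_def abs_le_iff) (smt (verit))
qed (fact assms(2))

text \<open>
  Minkowski's inequality along a coupling would give \<open>\<parallel>f\<parallel>\<^sub>P \<le> \<parallel>f\<parallel>\<^sub>Q + W\<^sub>r\<close>, and \<open>W\<^sub>r\<^sup>r \<le> D\<^sup>r\<^sup>-\<^sup>1 W\<^sub>1\<close>.
  The proof replaces the coupling by a test function \<open>h\<close> that is Lipschitz and that on \<open>I\<close> lies between
  \<open>\<bar>x\<bar>\<^sup>r\<close> and \<open>t\<^sup>1\<^sup>-\<^sup>r \<bar>x\<bar>\<^sup>r\<close>, and then optimizes over the weight \<open>t\<close>.
\<close>

lemma Lr_norm_le_of_lipschitz_integrals:
  fixes f :: "'a \<Rightarrow> real" and P Q :: "'a measure" and I :: "real set"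
  assumes P: "prob_space P" "f \<in> borel_measurable P" "AE z in P. f z \<in> I"
    and Q: "prob_space Q" "f \<in> borel_measurable Q" "AE z in Q. f z \<in> I"
    and r: "r \<ge> 1" and I: "bounded I" "\<And>x y. x \<in> I \<Longrightarrow> y \<in> I \<Longrightarrow> \<bar>x - y\<bar> \<le> D" and d: "d \<ge> 0"
    and lip: "\<And>L h. L-lipschitz_on UNIV h \<Longrightarrow> (\<integral>z. h (f z) \<partial>P) \<le> (\<integral>z. h (f z) \<partial>Q) + L * d"
  shows "(\<integral>z. \<bar>f z\<bar> powr r \<partial>P) powr (1 / r)
      \<le> (\<integral>z. \<bar>f z\<bar> powr r \<partial>Q) powr (1 / r) + (D powr (r - 1) * d) powr (1 / r)"
proof -
  interpret P: prob_space P by fact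
  interpret Q: prob_space Q by fact
  have "I \<noteq> {}" using P(3) P.AE_False by auto
  obtain R where R: "\<And>x. x \<in> I \<Longrightarrow> \<bar>x\<bar> \<le> R" using I(1) by (auto simp: bounded_iff)
  define A where "A = (\<integral>z. \<bar>f z\<bar> powr r \<partial>P)"
  define B where "B = (\<integral>z. \<bar>f z\<bar> powr r \<partial>Q)"
  have AB: "A \<ge> 0" "B \<ge> 0" by (simp_all add: A_def B_def)
  have pow: "\<bar>x\<bar> powr r \<le> R powr r" if "x \<in> I" for x
    using R[OF that] r by (intro powr_mono2) auto
  have int: "integrable P (\<lambda>z. \<bar>f z\<bar> powr r)" "integrable Q (\<lambda>z. \<bar>f z\<bar> powr r)"
    by (rule P.integrable_const_bound[where B="R powr r"] Q.integrable_const_bound[where B="R powr r"],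
        use P(3) Q(3) in \<open>auto elim!: eventually_mono simp: pow\<close>, use P(2) Q(2) in measurable)+
  \<comment> \<open>Working with \<open>b\<close> and \<open>s\<close> strictly above the two terms keeps the weight \<open>t\<close> inside \<open>]0, 1[\<close>
      even if a term vanishes.\<close>
  have main: "A powr (1 / r) \<le> b + s" if bs: "B powr (1 / r) < b" "(D powr (r - 1) * d) powr (1 / r) < s" for b s
  proof -
    have b0: "b > 0" and s0: "s > 0"
      using bs powr_ge_zero[of B "1 / r"] powr_ge_zero[of "D powr (r - 1) * d" "1 / r"] by linarith+
    have Bb: "B \<le> b powr r"
      using powr_mono2[of r "B powr (1 / r)" b] bs r AB by (simp add: powr_powr)
    have Ds: "D powr (r - 1) * d \<le> s powr r"
      using powr_mono2[of r "(D powr (r - 1) * d) powr (1 / r)" s] bs r d by (simp add: powr_powr)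
    \<comment> \<open>This weight turns the weighted inequality for \<open>b\<close> and \<open>s\<close> into the equality
      \<open>t\<^sup>1\<^sup>-\<^sup>r b\<^sup>r + (1 - t)\<^sup>1\<^sup>-\<^sup>r s\<^sup>r = (b + s)\<^sup>r\<close>.\<close>
    define t where "t = b / (b + s)"
    have t: "0 < t" "t < 1" and t': "1 - t = s / (b + s)" using b0 s0 by (auto simp: t_def field_simps)
    define L where "L = (1 - t) powr (1 - r) * D powr (r - 1)"
    have L: "L \<ge> 0" by (simp add: L_def)
    define g where "g y = t powr (1 - r) * \<bar>y\<bar> powr r" for y
    define h where "h x = (INF y\<in>I. g y + L * \<bar>x - y\<bar>)" for x
    have g0: "g y \<ge> 0" for y by (simp add: g_def)
    have h_lip: "L-lipschitz_on UNIV h"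
      unfolding h_def by (rule lipschitz_inf_convolution) (use \<open>I \<noteq> {}\<close> L g0 in auto)
    have bdd: "bdd_below ((\<lambda>y. g y + L * \<bar>x - y\<bar>) ` I)" for x
      by (rule bdd_belowI2[where m=0]) (use L g0 in auto)
    have h_up: "h x \<le> g x" if "x \<in> I" for x
      using cINF_lower[OF bdd that, of x] by (simp add: h_def)
    have h_lo: "\<bar>x\<bar> powr r \<le> h x" if x: "x \<in> I" for x
      unfolding h_def
    proof (rule cINF_greatest[OF \<open>I \<noteq> {}\<close>])
      fix y assume y: "y \<in> I"
      have "\<bar>x - y\<bar> powr r \<le> D powr (r - 1) * \<bar>x - y\<bar>"
      proof (cases "x = y")
        case False
        then have "\<bar>x - y\<bar> powr r = \<bar>x - y\<bar> powr (r - 1) * \<bar>x - y\<bar>"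
          using powr_add[of "\<bar>x - y\<bar>" "r - 1" 1] by simp
        also have "\<dots> \<le> D powr (r - 1) * \<bar>x - y\<bar>"
          using I(2)[OF x y] r by (intro mult_right_mono powr_mono2) auto
        finally show ?thesis .
      qed simp
      then have "(1 - t) powr (1 - r) * \<bar>x - y\<bar> powr r \<le> L * \<bar>x - y\<bar>"
        unfolding L_def mult.assoc by (intro mult_left_mono) auto
      moreover have "\<bar>x\<bar> powr r \<le> (\<bar>y\<bar> + \<bar>x - y\<bar>) powr r" using r by (intro powr_mono2) auto
      ultimately show "\<bar>x\<bar> powr r \<le> g y + L * \<bar>x - y\<bar>"
        using powr_add_le_weighted[OF r, of "\<bar>y\<bar>" "\<bar>x - y\<bar>" t] t unfolding g_def by linarith
    qed
    have h_meas: "h \<in> borel_measurable borel"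
      by (rule borel_measurable_continuous_onI[OF lipschitz_on_continuous_on[OF h_lip]])
    have h_bd: "\<bar>h x\<bar> \<le> t powr (1 - r) * R powr r" if "x \<in> I" for x
    proof -
      have "0 \<le> h x" using h_lo[OF that] powr_ge_zero[of "\<bar>x\<bar>" r] by linarith
      moreover have "g x \<le> t powr (1 - r) * R powr r"
        unfolding g_def using pow[OF that] by (intro mult_left_mono) auto
      ultimately show ?thesis using h_up[OF that] by linarith
    qed
    have h_int: "integrable P (\<lambda>z. h (f z))" "integrable Q (\<lambda>z. h (f z))"
       by (rule P.integrable_const_bound[where B="t powr (1 - r) * R powr r"]
             Q.integrable_const_bound[where B="t powr (1 - r) * R powr r"],
           use P(3) Q(3) in \<open>auto elim!: eventually_mono simp: h_bd\<close>,
           rule measurable_compose[OF _ h_meas], use P(2) Q(2) in auto)+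
    have "A \<le> (\<integral>z. h (f z) \<partial>P)"
      unfolding A_def using int h_int P(3) by (intro integral_mono_AE) (auto elim!: eventually_mono simp: h_lo)
    also have "\<dots> \<le> (\<integral>z. h (f z) \<partial>Q) + L * d" by (rule lip[OF h_lip])
    also have "(\<integral>z. h (f z) \<partial>Q) \<le> (\<integral>z. g (f z) \<partial>Q)"
      using int h_int Q(3) by (intro integral_mono_AE) (auto elim!: eventually_mono dest: h_up simp: g_def)
    also have "(\<integral>z. g (f z) \<partial>Q) = t powr (1 - r) * B" by (simp add: g_def B_def)
    also have "\<dots> \<le> t powr (1 - r) * b powr r" using Bb by (intro mult_left_mono) auto
    also have "L * d \<le> (1 - t) powr (1 - r) * s powr r"
      unfolding L_def mult.assoc using Ds by (intro mult_left_mono) auto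
    also have "t powr (1 - r) * b powr r + (1 - t) powr (1 - r) * s powr r = (b + s) powr r"
    proof -
      have "(c / (b + s)) powr (1 - r) * c powr r = c * (b + s) powr (r - 1)" if "c > 0" for c
      proof -
        have "c powr (1 - r) * c powr r = c" using that by (simp flip: powr_add)
        moreover have "1 / (b + s) powr (1 - r) = (b + s) powr (r - 1)"
          using powr_minus_divide[of "b + s" "1 - r"] by simp
        ultimately show ?thesis using that b0 s0
          by (simp add: powr_divide) (metis mult.commute times_divide_eq_right mult.right_neutral)
      qed
      then have "t powr (1 - r) * b powr r + (1 - t) powr (1 - r) * s powr r
          = (b + s) * (b + s) powr (r - 1)"
        unfolding t' unfolding t_def using b0 s0 by (simp add: algebra_simps)
      also have "\<dots> = (b + s) powr r" using powr_add[of "b + s" 1 "r - 1"] b0 s0 by simp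
      finally show ?thesis .
    qed
    finally have "A \<le> (b + s) powr r" by simp
    then have "A powr (1 / r) \<le> ((b + s) powr r) powr (1 / r)" using r AB by (intro powr_mono2) auto
    then show ?thesis using r b0 s0 by (simp add: powr_powr)
  qed
  have "A powr (1 / r) \<le> B powr (1 / r) + (D powr (r - 1) * d) powr (1 / r)"
  proof (rule field_le_epsilon)
    fix e :: real assume "e > 0"
    then show "A powr (1 / r) \<le> B powr (1 / r) + (D powr (r - 1) * d) powr (1 / r) + e"
      using main[of "B powr (1 / r) + e / 2" "(D powr (r - 1) * d) powr (1 / r) + e / 2"] by simp
  qed
  then show ?thesis by (simp add: A_def B_def)
qed

section \<open>Deviations of empirical averages\<close>

locale iid_sample = prob_space M for M :: "'w measure" +
  fixes P :: "'a::topological_space measure" and Z :: "nat \<Rightarrow> 'w \<Rightarrow> 'a" and n :: nat and S :: "'a set"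
  assumes n: "n \<ge> 1" and indep: "indep_vars (\<lambda>_. borel) Z {..<n}"
    and distr_Z: "\<And>i. i < n \<Longrightarrow> distr M borel (Z i) = P"
    and S_meas: "S \<in> sets borel" and AE_S: "AE z in P. z \<in> S"
begin

lemma Z_meas [measurable]: "i < n \<Longrightarrow> Z i \<in> M \<rightarrow>\<^sub>M borel"
  using indep unfolding indep_vars_def by auto

lemma P_distr: "P = distr M borel (Z 0)"
  using distr_Z[of 0] n by simp

lemma sets_P [measurable_cong]: "sets P = sets borel"
  by (simp add: P_distr)

lemma prob_space_P: "prob_space P"
  unfolding P_distr using n by (intro prob_space_distr) auto

sublocale P: prob_space P by (rule prob_space_P)

lemma borel_measurable_P: "g \<in> borel_measurable borel \<Longrightarrow> g \<in> borel_measurable P"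
  by (simp add: measurable_cong_sets[OF sets_P refl])

lemma S_nonempty: "S \<noteq> {}"
  using AE_S P.AE_False by auto

lemma AE_Z_S: "AE \<omega> in M. \<forall>i<n. Z i \<omega> \<in> S"
proof -
  have "AE \<omega> in M. Z i \<omega> \<in> S" if "i < n" for i
  proof -
    have "AE z in distr M borel (Z i). z \<in> S" unfolding distr_Z[OF that] by (rule AE_S)
    then show ?thesis using that S_meas by (subst (asm) AE_distr_iff) auto
  qed
  then show ?thesis by (simp add: AE_all_countable)
qed

lemma integrable_of_bounded_on_S:
  fixes g :: "'a \<Rightarrow> real"
  assumes "g \<in> borel_measurable borel" "\<And>z. z \<in> S \<Longrightarrow> \<bar>g z\<bar> \<le> K"
  shows "integrable P g"
  using AE_S assms
  by (intro P.integrable_const_bound[where B=K])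
     (auto elim!: eventually_mono simp: borel_measurable_P)

definition deviation :: "('a \<Rightarrow> real) \<Rightarrow> 'w \<Rightarrow> real" where
  "deviation g \<omega> = (\<Sum>i<n. g (Z i \<omega>)) / real n - (\<integral>z. g z \<partial>P)"

lemma deviation_measurable [measurable]:
  "g \<in> borel_measurable borel \<Longrightarrow> deviation g \<in> borel_measurable M"
  unfolding deviation_def
  by (intro borel_measurable_diff borel_measurable_divide borel_measurable_sum borel_measurable_const
        measurable_compose[OF Z_meas]) auto

lemma deviation_diff:
  assumes "integrable P f" "integrable P g"
  shows "deviation (\<lambda>z. f z - g z) \<omega> = deviation f \<omega> - deviation g \<omega>"
  using assms by (simp add: deviation_def sum_subtractf diff_divide_distrib)

lemma deviation_affine:
  assumes "integrable P f"
  shows "deviation (\<lambda>z. (f z - c) / \<kappa>) \<omega> = deviation f \<omega> / \<kappa>"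
proof -
  have "(\<Sum>i<n. (f (Z i \<omega>) - c) / \<kappa>) / real n = ((\<Sum>i<n. f (Z i \<omega>)) / real n - c) / \<kappa>"
    using n by (simp add: sum_divide_distrib[symmetric] sum_subtractf diff_divide_distrib mult.commute)
  moreover have "(\<integral>z. (f z - c) / \<kappa> \<partial>P) = ((\<integral>z. f z \<partial>P) - c) / \<kappa>"
    using assms by (simp add: P.prob_space)
  ultimately show ?thesis by (simp add: deviation_def diff_divide_distrib)
qed

lemma deviation_le_of_bounded:
  assumes "\<And>z. z \<in> S \<Longrightarrow> \<bar>g z\<bar> \<le> K" "integrable P g" "\<forall>i<n. Z i \<omega> \<in> S"
  shows "\<bar>deviation g \<omega>\<bar> \<le> 2 * K"
proof -
  have "\<bar>\<Sum>i<n. g (Z i \<omega>)\<bar> \<le> (\<Sum>i<n. K)"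
    using assms by (intro order_trans[OF sum_abs] sum_mono) auto
  then have 1: "\<bar>(\<Sum>i<n. g (Z i \<omega>)) / real n\<bar> \<le> K" using n by (simp add: abs_divide field_simps)
  have "\<bar>\<integral>z. g z \<partial>P\<bar> \<le> (\<integral>z. \<bar>g z\<bar> \<partial>P)" by (rule integral_abs_bound)
  also have "\<dots> \<le> (\<integral>z. K \<partial>P)"
    using assms AE_S by (intro integral_mono_AE) (auto elim!: eventually_mono)
  finally have "\<bar>\<integral>z. g z \<partial>P\<bar> \<le> K" by (simp add: P.prob_space)
  with 1 show ?thesis unfolding deviation_def by linarith
qed

lemma deviation_tail:
  fixes g :: "'a \<Rightarrow> real"
  assumes g: "g \<in> borel_measurable borel" and osc: "\<And>z z'. z \<in> S \<Longrightarrow> z' \<in> S \<Longrightarrow> \<bar>g z - g z'\<bar> \<le> w"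
    and w: "w > 0" and s: "s \<ge> 0"
  shows "prob {\<omega> \<in> space M. w * s / sqrt (real n) \<le> \<bar>deviation g \<omega>\<bar>} \<le> 2 * exp (- 2 * s\<^sup>2)"
proof -
  note [measurable] = g
  obtain z0 where z0: "z0 \<in> S" using S_nonempty by auto
  define l where "l = (INF z\<in>S. g z)"
  have bdd: "bdd_below (g ` S)"
    by (rule bdd_belowI2[where m="g z0 - w"]) (use osc[OF z0] in fastforce)
  have range: "g z \<in> {l..l + w}" if "z \<in> S" for z
  proof -
    have "g z - w \<le> l" unfolding l_def using osc[OF that] S_nonempty
      by (intro cINF_greatest) fastforce+
    moreover have "l \<le> g z" unfolding l_def by (rule cINF_lower[OF bdd that])
    ultimately show ?thesis by simp
  qed
  have mean: "expectation (\<lambda>\<omega>. g (Z 0 \<omega>)) = (\<integral>z. g z \<partial>P)"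
    unfolding P_distr using n g by (intro integral_distr[symmetric]) auto
  interpret Hoeffding_ineq_iid M "{..<n}" "\<lambda>i \<omega>. g (Z i \<omega>)" "\<lambda>\<omega>. g (Z 0 \<omega>)" l "l + w"
    "expectation (\<lambda>\<omega>. g (Z 0 \<omega>))"
  proof unfold_locales
    show "indep_vars (\<lambda>_. borel) (\<lambda>i \<omega>. g (Z i \<omega>)) {..<n}"
      by (rule indep_vars_compose2[OF indep]) simp
    show "random_variable borel (\<lambda>\<omega>. g (Z 0 \<omega>))"
      by (rule measurable_compose[OF Z_meas g]) (use n in auto)
    show "distr M borel (\<lambda>\<omega>. g (Z i \<omega>)) = distr M borel (\<lambda>\<omega>. g (Z 0 \<omega>))" if "i \<in> {..<n}" for i
    proof -
      have "distr (distr M borel (Z i)) borel g = distr (distr M borel (Z 0)) borel g"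
        using distr_Z[of i] distr_Z[of 0] n that by simp
      then show ?thesis using n that by (simp add: distr_distr comp_def)
    qed
    show "AE \<omega> in M. g (Z 0 \<omega>) \<in> {l..l + w}"
    proof (rule eventually_mono[OF AE_Z_S])
      fix \<omega> assume "\<forall>i<n. Z i \<omega> \<in> S"
      then have "Z 0 \<omega> \<in> S" using n by auto
      then show "g (Z 0 \<omega>) \<in> {l..l + w}" by (rule range)
    qed
  qed simp_all
  have "prob {\<omega> \<in> space M. w * s / sqrt (real n) \<le> \<bar>deviation g \<omega>\<bar>}
      \<le> 2 * exp (- 2 * real n * (w * s / sqrt (real n))\<^sup>2 / w\<^sup>2)"
    using Hoeffding_ineq_abs_ge'[of "w * s / sqrt (real n)"] w s n
    by (simp add: deviation_def mean lessThan_empty_iff del: expectation_X)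
  also have "- 2 * real n * (w * s / sqrt (real n))\<^sup>2 / w\<^sup>2 = - 2 * s\<^sup>2"
    using w n by (simp add: power_divide power_mult_distrib)
  finally show ?thesis .
qed

text \<open>
  The level \<open>w * s / sqrt n\<close> is proportional to the oscillation \<open>w\<close>, so that the failure probability depends
  on \<open>s\<close> only and the scales of a chain can be added up.
\<close>

lemma deviation_tail_Union:
  fixes F :: "('a \<Rightarrow> real) set"
  assumes "finite F" "\<And>a. a \<in> F \<Longrightarrow> a \<in> borel_measurable borel"
    "\<And>a z z'. a \<in> F \<Longrightarrow> z \<in> S \<Longrightarrow> z' \<in> S \<Longrightarrow> \<bar>a z - a z'\<bar> \<le> w" "w > 0" "s \<ge> 0"
  shows "prob (\<Union>a\<in>F. {\<omega> \<in> space M. w * s / sqrt (real n) \<le> \<bar>deviation a \<omega>\<bar>})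
      \<le> real (card F) * (2 * exp (- 2 * s\<^sup>2))"
proof -
  have [measurable]: "deviation a \<in> borel_measurable M" if "a \<in> F" for a
    using assms(2)[OF that] by (rule deviation_measurable)
  have "prob (\<Union>a\<in>F. {\<omega> \<in> space M. w * s / sqrt (real n) \<le> \<bar>deviation a \<omega>\<bar>})
      \<le> (\<Sum>a\<in>F. prob {\<omega> \<in> space M. w * s / sqrt (real n) \<le> \<bar>deviation a \<omega>\<bar>})"
    by (intro finite_measure_subadditive_finite assms(1)) auto
  also have "\<dots> \<le> (\<Sum>a\<in>F. 2 * exp (- 2 * s\<^sup>2))"
    using assms by (intro sum_mono deviation_tail) auto
  finally show ?thesis by simp
qed

text \<open>
  Write \<open>g\<close> as an element of the coarsest net, plus the differences between its approximations in
  successive nets, plus a remainder of size \<open>\<eta> L\<close>. The deviation of the first part is controlled through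
  its oscillation \<open>1 + 2 \<eta> 0\<close>, that of a difference between scales \<open>j\<close> and \<open>j + 1\<close> through its oscillation
  \<open>2 (\<eta> j + \<eta> (j + 1))\<close>, and that of the remainder trivially. There are \<open>c k\<close> candidates for the part
  numbered \<open>k\<close>, and \<open>t k\<close> is the bound for its deviation up to the factor \<open>1 / sqrt n\<close>.
\<close>

theorem chaining_bound:
  fixes \<G> :: "('a \<Rightarrow> real) set" and G :: "nat \<Rightarrow> ('a \<Rightarrow> real) set" and \<eta> s :: "nat \<Rightarrow> real" and L :: nat
  defines "t \<equiv> \<lambda>k. case k of 0 \<Rightarrow> (1 + 2 * \<eta> 0) * s 0 | Suc j \<Rightarrow> 2 * (\<eta> j + \<eta> (Suc j)) * s (Suc j)"
    and "c \<equiv> \<lambda>k. case k of 0 \<Rightarrow> card (G 0) | Suc j \<Rightarrow> card (G j) * card (G (Suc j))"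
  assumes \<G>_meas: "\<And>g. g \<in> \<G> \<Longrightarrow> g \<in> borel_measurable borel"
    and \<G>_osc: "\<And>g z z'. g \<in> \<G> \<Longrightarrow> z \<in> S \<Longrightarrow> z' \<in> S \<Longrightarrow> \<bar>g z - g z'\<bar> \<le> 1"
    and G_fin: "\<And>k. finite (G k)" and G_meas: "\<And>k a. a \<in> G k \<Longrightarrow> a \<in> borel_measurable borel"
    and net: "\<And>k g. g \<in> \<G> \<Longrightarrow> \<exists>a\<in>G k. \<forall>z\<in>S. \<bar>g z - a z\<bar> \<le> \<eta> k"
    and \<eta>: "\<And>k. \<eta> k > 0" and s: "\<And>k. s k \<ge> 0"
  shows "\<exists>E\<in>events. prob E \<ge> 1 - (\<Sum>k\<le>L. real (c k) * (2 * exp (- 2 * (s k)\<^sup>2))) \<and>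
    (\<forall>\<omega>\<in>E. \<forall>i<n. Z i \<omega> \<in> S) \<and>
    (\<forall>\<omega>\<in>E. \<forall>g\<in>\<G>. \<bar>deviation g \<omega>\<bar> \<le> (\<Sum>k\<le>L. t k) / sqrt (real n) + 2 * \<eta> L)"
proof -
  define near where "near k g a \<longleftrightarrow> (\<forall>z\<in>S. \<bar>g z - a z\<bar> \<le> \<eta> k)" for k and g a :: "'a \<Rightarrow> real"
  \<comment> \<open>Only net elements near some \<open>g\<close> in the class, and only pairs near a common \<open>g\<close>, have controlled oscillation.\<close>
  define F where "F k = (case k of 0 \<Rightarrow> {a \<in> G 0. \<exists>g\<in>\<G>. near 0 g a}
    | Suc j \<Rightarrow> (\<lambda>(a, b). (\<lambda>z. b z - a z)) ` {(a, b). a \<in> G j \<and> b \<in> G k \<and> (\<exists>g\<in>\<G>. near j g a \<and> near k g b)})" for k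
  define w where "w k = (case k of 0 \<Rightarrow> 1 + 2 * \<eta> 0 | Suc j \<Rightarrow> 2 * (\<eta> j + \<eta> (Suc j)))" for k
  have w: "w k > 0" for k using \<eta> by (auto simp: w_def add_pos_pos split: nat.split)
  have t: "t k = w k * s k" for k by (simp add: t_def w_def split: nat.split)
  have sub: "{(a, b). a \<in> G j \<and> b \<in> G k \<and> (\<exists>g\<in>\<G>. near j g a \<and> near k g b)} \<subseteq> G j \<times> G k" for j k by auto
  have fin2: "finite {(a, b). a \<in> G j \<and> b \<in> G k \<and> (\<exists>g\<in>\<G>. near j g a \<and> near k g b)}" for j k
    by (rule finite_subset[OF sub]) (simp add: G_fin)
  have F_fin: "finite (F k)" for k using fin2 G_fin by (auto simp: F_def split: nat.split)
  have F_card: "card (F k) \<le> c k" for k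
  proof (cases k)
    case 0
    then show ?thesis using G_fin by (auto simp: F_def c_def intro: card_mono)
  next
    case (Suc j)
    have "card (F k) \<le> card {(a, b). a \<in> G j \<and> b \<in> G k \<and> (\<exists>g\<in>\<G>. near j g a \<and> near k g b)}"
      unfolding F_def Suc nat.case using fin2 by (rule card_image_le)
    also have "\<dots> \<le> card (G j \<times> G k)" by (intro card_mono sub) (simp add: G_fin)
    finally show ?thesis by (simp add: c_def Suc card_cartesian_product)
  qed
  have F_meas: "a \<in> borel_measurable borel" if "a \<in> F k" for a k
    using that G_meas by (auto simp: F_def split: nat.splits)
  have F_osc: "\<bar>a z - a z'\<bar> \<le> w k" if a: "a \<in> F k" and z: "z \<in> S" "z' \<in> S" for a k z z'
  proof (cases k)
    case 0
    then obtain g where g: "g \<in> \<G>" "near 0 g a" using a by (auto simp: F_def)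
    have "\<bar>g z - a z\<bar> \<le> \<eta> 0" "\<bar>g z' - a z'\<bar> \<le> \<eta> 0" using g(2) z by (auto simp: near_def)
    then show ?thesis using \<G>_osc[OF g(1) z] by (simp add: w_def 0)
  next
    case (Suc j)
    then obtain x y g where g: "near j g x" "near k g y" "a = (\<lambda>z. y z - x z)"
      using a by (auto simp: F_def)
    have "\<bar>a v\<bar> \<le> \<eta> j + \<eta> k" if "v \<in> S" for v
    proof -
      have "\<bar>g v - x v\<bar> \<le> \<eta> j" "\<bar>g v - y v\<bar> \<le> \<eta> k" using g(1,2) that by (auto simp: near_def)
      then show ?thesis by (simp add: g(3))
    qed
    from this[OF z(1)] this[OF z(2)] show ?thesis by (simp add: w_def Suc)
  qed
  define Bad where "Bad k = (\<Union>a\<in>F k. {\<omega> \<in> space M. w k * s k / sqrt (real n) \<le> \<bar>deviation a \<omega>\<bar>})" for k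
  have Bad_ev: "Bad k \<in> events" for k
  proof -
    have [measurable]: "deviation a \<in> borel_measurable M" if "a \<in> F k" for a
      using F_meas[OF that] by (rule deviation_measurable)
    show ?thesis unfolding Bad_def using F_fin by (intro sets.finite_UN) auto
  qed
  have Bad_prob: "prob (Bad k) \<le> real (c k) * (2 * exp (- 2 * (s k)\<^sup>2))" for k
  proof -
    have "prob (Bad k) \<le> real (card (F k)) * (2 * exp (- 2 * (s k)\<^sup>2))"
      unfolding Bad_def by (rule deviation_tail_Union) (use F_fin F_meas F_osc w s in auto)
    also have "\<dots> \<le> real (c k) * (2 * exp (- 2 * (s k)\<^sup>2))"
      using F_card[of k] by (intro mult_right_mono) auto
    finally show ?thesis .
  qed
  define In where "In = {\<omega> \<in> space M. \<forall>i<n. Z i \<omega> \<in> S}"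
  have In_ev: "In \<in> events"
  proof -
    have "In = space M \<inter> (\<Inter>i\<in>{..<n}. Z i -` S \<inter> space M)" using n by (auto simp: In_def)
    then show ?thesis using n S_meas by (auto intro!: sets.finite_INT measurable_sets[OF Z_meas])
  qed
  have In_prob: "prob In = 1"
    unfolding prob_eq_1[OF In_ev] using AE_Z_S AE_space by eventually_elim (simp add: In_def)
  define E where "E = In - (\<Union>k\<le>L. Bad k)"
  have UBad: "(\<Union>k\<le>L. Bad k) \<in> events" using Bad_ev by auto
  have "prob (\<Union>k\<le>L. Bad k) \<le> (\<Sum>k\<le>L. prob (Bad k))"
    using Bad_ev by (intro finite_measure_subadditive_finite) auto
  also have "\<dots> \<le> (\<Sum>k\<le>L. real (c k) * (2 * exp (- 2 * (s k)\<^sup>2)))" by (intro sum_mono Bad_prob)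
  finally have "prob E \<ge> 1 - (\<Sum>k\<le>L. real (c k) * (2 * exp (- 2 * (s k)\<^sup>2)))"
    using In_prob finite_measure_Diff'[OF In_ev UBad] finite_measure_mono[of "In \<inter> (\<Union>k\<le>L. Bad k)" "\<Union>k\<le>L. Bad k"] UBad
    unfolding E_def by force
  moreover have "\<bar>deviation g \<omega>\<bar> \<le> (\<Sum>k\<le>L. t k) / sqrt (real n) + 2 * \<eta> L"
    if \<omega>: "\<omega> \<in> E" and g: "g \<in> \<G>" for \<omega> g
  proof -
    have \<omega>S: "\<forall>i<n. Z i \<omega> \<in> S" and \<omega>M: "\<omega> \<in> space M" using \<omega> by (auto simp: E_def In_def)
    have dev: "\<bar>deviation a \<omega>\<bar> \<le> t k / sqrt (real n)" if "k \<le> L" "a \<in> F k" for k a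
      using \<omega> \<omega>M that by (force simp: E_def Bad_def t)
    obtain a where a: "\<And>k. a k \<in> G k" "\<And>k. near k g (a k)"
      using net[OF g] unfolding near_def by metis
    obtain z0 where z0: "z0 \<in> S" using S_nonempty by auto
    have g_bd: "\<bar>g z\<bar> \<le> \<bar>g z0\<bar> + 1" if "z \<in> S" for z using \<G>_osc[OF g that z0] by linarith
    have g_int: "integrable P g" by (rule integrable_of_bounded_on_S[OF \<G>_meas[OF g] g_bd])
    have a_int: "integrable P (a k)" for k
    proof (rule integrable_of_bounded_on_S[OF G_meas[OF a(1)]])
      fix z assume z: "z \<in> S"
      have "\<bar>g z - a k z\<bar> \<le> \<eta> k" using a(2)[of k] z by (auto simp: near_def)
      then show "\<bar>a k z\<bar> \<le> \<bar>g z0\<bar> + 1 + \<eta> k" using g_bd[OF z] by linarith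
    qed
    have chain: "\<bar>deviation (a l) \<omega>\<bar> \<le> (\<Sum>k\<le>l. t k / sqrt (real n))" if "l \<le> L" for l
      using that
    proof (induction l)
      case 0
      have "a 0 \<in> F 0" using a g by (auto simp: F_def)
      then show ?case using dev[of 0 "a 0"] by simp
    next
      case (Suc l)
      have "(\<lambda>z. a (Suc l) z - a l z) \<in> F (Suc l)"
        using a g by (auto simp: F_def intro!: image_eqI[where x="(a l, a (Suc l))"])
      from dev[OF Suc.prems this] show ?case
        using Suc by (simp add: deviation_diff[OF a_int a_int])
    qed
    have "\<bar>deviation (\<lambda>z. g z - a L z) \<omega>\<bar> \<le> 2 * \<eta> L"
      using a(2)[of L] g_int a_int \<omega>S by (intro deviation_le_of_bounded) (auto simp: near_def)
    then have "\<bar>deviation g \<omega>\<bar> \<le> \<bar>deviation (a L) \<omega>\<bar> + 2 * \<eta> L"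
      by (simp add: deviation_diff[OF g_int a_int])
    with chain[of L] show ?thesis by (simp add: sum_divide_distrib)
  qed
  moreover have "\<forall>\<omega>\<in>E. \<forall>i<n. Z i \<omega> \<in> S" by (auto simp: E_def In_def)
  moreover have "E \<in> events" unfolding E_def using In_ev UBad by (rule sets.Diff)
  ultimately show ?thesis by blast
qed

end

section \<open>Concentration for Lipschitz functions of projections\<close>

text \<open>
  The choice of scales: the nets have resolution \<open>6 / q k\<close> with \<open>q k = 64 * 4 ^ k\<close>. The ratio \<open>4\<close> makes
  the square roots of the entropies, which are of order \<open>sqrt (q k)\<close>, powers of \<open>2\<close>. The starting value
  \<open>64\<close> is large enough for the oscillations to sum to at most \<open>2\<close>, which is the coefficient of \<open>l\<close>.
\<close>

lemma chaining_budget: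
  fixes K l :: real and q :: "nat \<Rightarrow> nat"
  assumes K: "K \<ge> 1" and l: "l \<ge> 0"
  defines "q \<equiv> \<lambda>k. 64 * 4 ^ k"
  defines "s \<equiv> \<lambda>k. case k of 0 \<Rightarrow> 9 * K + l | Suc j \<Rightarrow> 24 * 2 ^ j * K + l"
  shows "(\<Sum>k\<le>L. case k of 0 \<Rightarrow> (1 + 2 * (6 / real (q 0))) * s 0
            | Suc j \<Rightarrow> 2 * (6 / real (q j) + 6 / real (q (Suc j))) * s (Suc j)) \<le> 22 * K + 2 * l"
    (is "(\<Sum>k\<le>L. ?t k) \<le> _")
proof -
  have t0: "?t 0 = (19/16) * 9 * K + (19/16) * l" by (simp add: q_def s_def algebra_simps)
  have tS: "?t (Suc j) = 45/8 * (1/2) ^ j * K + 15/64 * (1/4) ^ j * l" for j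
  proof -
    have "2 * (6 / real (q j) + 6 / real (q (Suc j))) = 15/64 * (1/4) ^ j"
      by (simp add: q_def power_one_over field_simps)
    then have "?t (Suc j) = 15/64 * (1/4) ^ j * (24 * 2 ^ j * K + l)" by (simp only: s_def nat.case)
    also have "\<dots> = 45/8 * ((1/4) ^ j * 2 ^ j) * K + 15/64 * (1/4) ^ j * l" by (simp add: algebra_simps)
    also have "(1/4) ^ j * (2::real) ^ j = (1/2) ^ j"
      by (simp add: power_mult_distrib[symmetric])
    finally show ?thesis .
  qed
  have g2: "(\<Sum>j<L. (1/2::real) ^ j) \<le> 2" by (simp add: sum_gp_strict)
  have g4: "(\<Sum>j<L. (1/4::real) ^ j) \<le> 4/3" by (simp add: sum_gp_strict)
  have "(\<Sum>k\<le>L. ?t k) = ?t 0 + (\<Sum>j<L. ?t (Suc j))" by (rule sum.atMost_shift)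
  also have "(\<Sum>j<L. ?t (Suc j)) = 45/8 * K * (\<Sum>j<L. (1/2) ^ j) + 15/64 * l * (\<Sum>j<L. (1/4) ^ j)"
    unfolding tS by (simp add: sum.distrib sum_distrib_left sum_distrib_right sum_divide_distrib ac_simps)
  also have "\<dots> \<le> 45/8 * K * 2 + 15/64 * l * (4/3)"
    using K l by (intro add_mono mult_left_mono g2 g4) auto
  finally show ?thesis unfolding t0 using K l by simp
qed

text \<open>
  With the same scales, the levels \<open>s k\<close> beat the number of candidates, so that the part numbered \<open>k\<close>
  fails with probability at most \<open>\<alpha> / 2 ^ (k + 1)\<close>. The first summand of \<open>s k\<close> pays for the number of
  candidates, the second one for \<open>\<alpha>\<close>.
\<close>

lemma chaining_failure:
  fixes \<alpha> :: real and m :: nat and c q :: "nat \<Rightarrow> nat"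
  assumes \<alpha>: "0 < \<alpha>" "\<alpha> < 1"
  defines "q \<equiv> \<lambda>k. 64 * 4 ^ k"
  defines "s \<equiv> \<lambda>k. case k of 0 \<Rightarrow> 9 * sqrt (real (m + 1)) + sqrt (ln (1 / \<alpha>) / 2)
      | Suc j \<Rightarrow> 24 * 2 ^ j * sqrt (real (m + 1)) + sqrt (ln (1 / \<alpha>) / 2)"
  assumes c: "\<And>k. real (c k) \<le> exp (real ((m + 2) * q k))"
  shows "(\<Sum>k\<le>L. real (case k of 0 \<Rightarrow> c 0 | Suc j \<Rightarrow> c j * c (Suc j)) * (2 * exp (- 2 * (s k)\<^sup>2))) \<le> \<alpha>"
    (is "(\<Sum>k\<le>L. real (?c k) * _) \<le> _")
proof -
  define K where "K = real (m + 1)"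
  define l where "l = ln (1 / \<alpha>) / 2"
  have K: "K \<ge> 1" "real (m + 2) \<le> 2 * K" by (auto simp: K_def)
  have l: "l \<ge> 0" "exp (- 2 * l) = \<alpha>" using \<alpha> by (auto simp: l_def ln_div)
  \<comment> \<open>The last condition leaves room for the factor \<open>2 ^ (k + 2)\<close>, by \<open>2 \<le> exp 1\<close>.\<close>
  have key: "real (?c k) * (2 * exp (- 2 * (s k)\<^sup>2)) \<le> \<alpha> * (1/2) ^ Suc k"
    if C: "real (?c k) \<le> exp x" and A: "A + l \<le> (s k)\<^sup>2" and x: "x + real k + 2 \<le> 2 * A" for k x A
  proof -
    have "(2::real) ^ (k + 2) \<le> exp 1 ^ (k + 2)"
      using exp_ge_add_one_self[of 1] by (intro power_mono) auto
    also have "\<dots> = exp (real (k + 2) * 1)" by (rule exp_of_nat_mult[symmetric])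
    also have "real (k + 2) * 1 = real k + 2" by simp
    finally have 2: "2 ^ (k + 2) \<le> exp (real k + 2)" .
    have "exp (- 2 * (s k)\<^sup>2) \<le> exp (- 2 * A + - 2 * l)" using A by simp
    also have "\<dots> = exp (- 2 * A) * exp (- 2 * l)" by (rule exp_add)
    also have "\<dots> = \<alpha> * exp (- 2 * A)" unfolding l(2) by (rule mult.commute)
    finally have "real (?c k) * (2 * exp (- 2 * (s k)\<^sup>2)) \<le> exp x * (2 * (\<alpha> * exp (- 2 * A)))"
      using C by (intro mult_mono) auto
    also have "\<dots> = 2 * \<alpha> * exp (x - 2 * A)" by (simp add: exp_diff exp_minus field_simps)
    also have "\<dots> \<le> 2 * \<alpha> * exp (- (real k + 2))" using x \<alpha> by (intro mult_left_mono) auto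
    also have "\<dots> = 2 * \<alpha> / exp (real k + 2)" by (simp only: exp_minus) (simp add: field_simps)
    also have "\<dots> \<le> 2 * \<alpha> / 2 ^ (k + 2)" using 2 \<alpha> by (intro divide_left_mono) auto
    also have "\<dots> = \<alpha> * (1/2) ^ Suc k" by (simp add: power_one_over field_simps)
    finally show ?thesis .
  qed
  have sq: "x\<^sup>2 + y\<^sup>2 \<le> (x + y)\<^sup>2" if "x \<ge> 0" "y \<ge> 0" for x y :: real
    using that by (simp add: power2_sum)
  have each: "real (?c k) * (2 * exp (- 2 * (s k)\<^sup>2)) \<le> \<alpha> * (1/2) ^ Suc k" for k
  proof (cases k)
    case 0
    show ?thesis
    proof (rule key)
      show "real (?c k) \<le> exp (real ((m + 2) * 64))" using c[of 0] by (simp add: 0 q_def)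
      show "81 * K + l \<le> (s k)\<^sup>2"
        using sq[of "9 * sqrt K" "sqrt l"] K l by (simp add: 0 s_def K_def l_def power_mult_distrib)
      show "real ((m + 2) * 64) + real k + 2 \<le> 2 * (81 * K)" unfolding of_nat_mult using K by (simp add: 0)
    qed
  next
    case (Suc j)
    show ?thesis
    proof (rule key)
      have "real (?c k) \<le> exp (real ((m + 2) * q j)) * exp (real ((m + 2) * q (Suc j)))"
        unfolding Suc nat.case of_nat_mult[of "c j"] by (intro mult_mono c) auto
      then show "real (?c k) \<le> exp (real (m + 2) * (5 * real (q j)))"
        by (simp add: exp_add[symmetric] q_def algebra_simps)
      have "(24 * 2 ^ j * sqrt K)\<^sup>2 = 576 * (2 ^ j * 2 ^ j) * K"
        using K by (simp add: power_mult_distrib power2_eq_square)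
      also have "(2::real) ^ j * 2 ^ j = 4 ^ j" by (simp add: power_mult_distrib[symmetric])
      finally have "(24 * 2 ^ j * sqrt K)\<^sup>2 = 9 * K * real (q j)" by (simp add: q_def)
      then show "9 * K * real (q j) + l \<le> (s k)\<^sup>2"
        using sq[of "24 * 2 ^ j * sqrt K" "sqrt l"] K l by (simp add: Suc s_def K_def l_def)
      have "real j \<le> 2 ^ j" using of_nat_less_two_power[of j, where 'a=real] by simp
      also have "(2::real) ^ j \<le> 4 ^ j" by (intro power_mono) auto
      finally have "real j \<le> 4 ^ j" .
      moreover have "1 \<le> (4::real) ^ j" by simp
      moreover have "real (q j) = 64 * 4 ^ j" by (simp add: q_def)
      ultimately have j: "real j + 3 \<le> 8 * real (q j)" by linarith
      have "real (m + 2) * (5 * real (q j)) \<le> 2 * K * (5 * real (q j))" using K by (intro mult_right_mono) auto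
      moreover have "8 * real (q j) \<le> K * (8 * real (q j))"
        using mult_right_mono[OF K(1), of "8 * real (q j)"] by simp
      moreover have "2 * K * (5 * real (q j)) + K * (8 * real (q j)) = 2 * (9 * K * real (q j))" by algebra
      moreover have "real k = real j + 1" by (simp add: Suc)
      ultimately show "real (m + 2) * (5 * real (q j)) + real k + 2 \<le> 2 * (9 * K * real (q j))"
        using j by linarith
    qed
  qed
  have "(\<Sum>k\<le>L. real (?c k) * (2 * exp (- 2 * (s k)\<^sup>2))) \<le> (\<Sum>k\<le>L. \<alpha> * (1/2) ^ Suc k)"
    by (intro sum_mono each)
  also have "\<dots> = \<alpha> / 2 * (\<Sum>k<Suc L. (1/2) ^ k)" by (simp add: sum_distrib_left lessThan_Suc_atMost del: sum.lessThan_Suc)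
  also have "\<dots> \<le> \<alpha> / 2 * 2" using \<alpha> by (intro mult_left_mono) (simp_all add: sum_gp_strict del: sum.lessThan_Suc)
  finally show ?thesis by simp
qed

text \<open>
  Chaining with \<open>n\<close> scales, which is enough because \<open>1 / 4 ^ n \<le> 1 / sqrt n\<close>. The class to which it is
  applied is normalized: the sample is rescaled to diameter at most \<open>1\<close>, directions have norm at most \<open>1\<close>,
  and profiles are 1-Lipschitz and vanish at \<open>-1\<close>. Any Lipschitz function of a projection is an affine
  image of such a function, and a deviation does not see additive constants.
\<close>

theorem lipschitz_projection_concentration:
  fixes N :: "'a::euclidean_space \<Rightarrow> real" and S :: "'a set"
  assumes iid: "iid_sample M P Z n S" and N: "is_norm N"
    and D: "D \<ge> 0" "\<And>u z z'. z \<in> S \<Longrightarrow> z' \<in> S \<Longrightarrow> \<bar>u \<bullet> (z - z')\<bar> \<le> N u * D"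
    and \<alpha>: "0 < \<alpha>" "\<alpha> < 1"
  shows "\<exists>E\<in>sets M. measure M E \<ge> 1 - \<alpha> \<and> (\<forall>\<omega>\<in>E. (\<forall>i<n. Z i \<omega> \<in> S) \<and>
    (\<forall>u L h. L-lipschitz_on UNIV h \<longrightarrow> \<bar>iid_sample.deviation P Z n (\<lambda>z. h (u \<bullet> z)) \<omega>\<bar>
      \<le> L * N u * D * ((23 * sqrt (real (DIM('a) + 1)) + sqrt (2 * ln (1 / \<alpha>))) / sqrt (real n))))"
proof -
  interpret iid_sample M P Z n S by (rule iid)
  obtain z0 where z0: "z0 \<in> S" using S_nonempty by auto
  \<comment> \<open>A support of diameter \<open>0\<close> is left unscaled; its deviations vanish anyway.\<close>
  define D1 where "D1 = (if D = 0 then 1 else D)"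
  have D1: "D1 > 0" "D \<le> D1" using D by (auto simp: D1_def)
  define \<phi> where "\<phi> z = (1 / D1) *\<^sub>R (z - z0)" for z
  have \<phi>: "\<bar>v \<bullet> \<phi> z - v \<bullet> \<phi> z'\<bar> \<le> N v" if "z \<in> S" "z' \<in> S" for v z z'
  proof -
    have "v \<bullet> \<phi> z - v \<bullet> \<phi> z' = (v \<bullet> (z - z')) / D1"
      by (simp add: \<phi>_def inner_diff_right diff_divide_distrib)
    moreover have "\<bar>v \<bullet> (z - z')\<bar> \<le> N v * D1"
      using D(2)[OF that, of v] mult_left_mono[OF D1(2) is_normD(1)[OF N, of v]] by linarith
    ultimately show ?thesis using D1(1) by (simp add: abs_divide divide_le_eq)
  qed
  have \<phi>1: "\<bar>v \<bullet> \<phi> z\<bar> \<le> N v" if "z \<in> S" for v z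
    using \<phi>[OF that z0, of v] by (simp add: \<phi>_def[of z0])
  have \<phi>_meas: "\<phi> \<in> borel \<rightarrow>\<^sub>M borel" unfolding \<phi>_def by simp
  define \<G> where "\<G> = {(\<lambda>z. h (u \<bullet> \<phi> z)) | u h. N u \<le> 1 \<and> 1-lipschitz_on UNIV h \<and> h (-1) = (0::real)}"
  define q :: "nat \<Rightarrow> nat" where "q = (\<lambda>k. 64 * 4 ^ k)"
  define m where "m = DIM('a)"
  define K where "K = sqrt (real (m + 1))"
  define l where "l = sqrt (ln (1 / \<alpha>) / 2)"
  define s where "s = (\<lambda>k. case k of 0 \<Rightarrow> 9 * K + l | Suc j \<Rightarrow> 24 * 2 ^ j * K + l)"
  have K: "K \<ge> 1" and l: "l \<ge> 0" using \<alpha> by (auto simp: K_def l_def)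
  have "\<exists>G. finite G \<and> real (card G) \<le> exp (real ((m + 2) * q k)) \<and>
    (\<forall>a\<in>G. a \<in> borel_measurable borel) \<and>
    (\<forall>u h. N u \<le> 1 \<longrightarrow> 1-lipschitz_on UNIV h \<longrightarrow> h (-1) = 0 \<longrightarrow>
      (\<exists>a\<in>G. \<forall>x. (\<forall>v. \<bar>v \<bullet> x\<bar> \<le> N v) \<longrightarrow> \<bar>h (u \<bullet> x) - a x\<bar> \<le> 6 / real (q k)))" for k
  proof -
    have "q k > 0" by (simp add: q_def)
    then show ?thesis unfolding m_def by (rule ridge_function_net[OF N]) blast
  qed
  then obtain G0 where G0: "\<And>k. finite (G0 k)" "\<And>k. real (card (G0 k)) \<le> exp (real ((m + 2) * q k))"
    "\<And>k a. a \<in> G0 k \<Longrightarrow> a \<in> borel_measurable borel"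
    "\<And>k u h. N u \<le> 1 \<Longrightarrow> 1-lipschitz_on UNIV h \<Longrightarrow> h (-1) = 0 \<Longrightarrow>
      \<exists>a\<in>G0 k. \<forall>x. (\<forall>v. \<bar>v \<bullet> x\<bar> \<le> N v) \<longrightarrow> \<bar>h (u \<bullet> x) - a x\<bar> \<le> 6 / real (q k)"
    by metis
  define G where "G k = (\<lambda>a. a \<circ> \<phi>) ` G0 k" for k
  have G_card: "real (card (G k)) \<le> exp (real ((m + 2) * q k))" for k
    using card_image_le[OF G0(1), of "\<lambda>a. a \<circ> \<phi>" k] G0(2)[of k] unfolding G_def by linarith
  have lip_meas: "(\<lambda>z. h (u \<bullet> f z)) \<in> borel_measurable borel"
    if "L-lipschitz_on UNIV h" "f \<in> borel \<rightarrow>\<^sub>M borel" for L :: real and h :: "real \<Rightarrow> real" and u and f :: "'a \<Rightarrow> 'a"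
  proof -
    have "(\<lambda>z. u \<bullet> f z) \<in> borel \<rightarrow>\<^sub>M borel" using that(2) by simp
    moreover have "h \<in> borel_measurable borel"
      by (rule borel_measurable_continuous_onI[OF lipschitz_on_continuous_on[OF that(1)]])
    ultimately show ?thesis by (rule measurable_compose)
  qed
  have "\<exists>E\<in>events. prob E \<ge> 1 - (\<Sum>k\<le>n. real (case k of 0 \<Rightarrow> card (G 0) | Suc j \<Rightarrow> card (G j) * card (G (Suc j))) *
      (2 * exp (- 2 * (s k)\<^sup>2))) \<and> (\<forall>\<omega>\<in>E. \<forall>i<n. Z i \<omega> \<in> S) \<and>
    (\<forall>\<omega>\<in>E. \<forall>g\<in>\<G>. \<bar>deviation g \<omega>\<bar> \<le> (\<Sum>k\<le>n. case k of 0 \<Rightarrow> (1 + 2 * (6 / real (q 0))) * s 0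
            | Suc j \<Rightarrow> 2 * (6 / real (q j) + 6 / real (q (Suc j))) * s (Suc j)) / sqrt (real n) + 2 * (6 / real (q n)))"
  proof (rule chaining_bound[where \<G>=\<G> and G=G and \<eta>="\<lambda>k. 6 / real (q k)" and s=s and L=n])
    show "g \<in> borel_measurable borel" if "g \<in> \<G>" for g
      using that lip_meas[OF _ \<phi>_meas] by (auto simp: \<G>_def)
    show "\<bar>g z - g z'\<bar> \<le> 1" if "g \<in> \<G>" "z \<in> S" "z' \<in> S" for g z z'
    proof -
      obtain u h where u: "N u \<le> 1" and h: "1-lipschitz_on UNIV h" and g: "g = (\<lambda>z. h (u \<bullet> \<phi> z))"
        using \<open>g \<in> \<G>\<close> by (auto simp: \<G>_def)
      have "\<bar>g z - g z'\<bar> \<le> \<bar>u \<bullet> \<phi> z - u \<bullet> \<phi> z'\<bar>"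
        using lipschitz_onD[OF h, of "u \<bullet> \<phi> z" "u \<bullet> \<phi> z'"] by (simp add: dist_real_def g)
      with \<phi>[OF that(2,3), of u] u show ?thesis by linarith
    qed
    show "finite (G k)" for k using G0(1) by (simp add: G_def)
    show "a \<in> borel_measurable borel" if "a \<in> G k" for k a
      using that measurable_comp[OF \<phi>_meas G0(3)] by (auto simp: G_def)
    show "\<exists>a\<in>G k. \<forall>z\<in>S. \<bar>g z - a z\<bar> \<le> 6 / real (q k)" if "g \<in> \<G>" for k g
    proof -
      obtain u h where u: "N u \<le> 1" and h: "1-lipschitz_on UNIV h" "h (-1) = 0" and g: "g = (\<lambda>z. h (u \<bullet> \<phi> z))"
        using \<open>g \<in> \<G>\<close> by (auto simp: \<G>_def)
      obtain a where "a \<in> G0 k" "\<And>x. (\<forall>v. \<bar>v \<bullet> x\<bar> \<le> N v) \<Longrightarrow> \<bar>h (u \<bullet> x) - a x\<bar> \<le> 6 / real (q k)"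
        using G0(4)[OF u h, of k] by blast
      then show ?thesis unfolding G_def g using \<phi>1 by (intro bexI[of _ "a \<circ> \<phi>"]) auto
    qed
    show "6 / real (q k) > 0" for k by (simp add: q_def)
    show "s k \<ge> 0" for k using K l by (auto simp: s_def split: nat.split)
  qed
  then obtain E where E: "E \<in> events" "\<And>\<omega>. \<omega> \<in> E \<Longrightarrow> \<forall>i<n. Z i \<omega> \<in> S"
    and E_prob: "prob E \<ge> 1 - (\<Sum>k\<le>n. real (case k of 0 \<Rightarrow> card (G 0) | Suc j \<Rightarrow> card (G j) * card (G (Suc j))) *
      (2 * exp (- 2 * (s k)\<^sup>2)))"
    and E_dev: "\<And>\<omega> g. \<omega> \<in> E \<Longrightarrow> g \<in> \<G> \<Longrightarrow> \<bar>deviation g \<omega>\<bar> \<le> (\<Sum>k\<le>n. case k of 0 \<Rightarrow> (1 + 2 * (6 / real (q 0))) * s 0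
            | Suc j \<Rightarrow> 2 * (6 / real (q j) + 6 / real (q (Suc j))) * s (Suc j)) / sqrt (real n) + 2 * (6 / real (q n))"
    by blast
  have "(\<Sum>k\<le>n. real (case k of 0 \<Rightarrow> card (G 0) | Suc j \<Rightarrow> card (G j) * card (G (Suc j))) *
      (2 * exp (- 2 * (s k)\<^sup>2))) \<le> \<alpha>"
    unfolding s_def K_def l_def
    by (rule chaining_failure[OF \<alpha>, of "\<lambda>k. card (G k)"]) (use G_card in \<open>simp add: q_def\<close>)
  then have E_prob': "prob E \<ge> 1 - \<alpha>" using E_prob by linarith
  define \<tau> where "\<tau> = (23 * sqrt (real (m + 1)) + sqrt (2 * ln (1 / \<alpha>))) / sqrt (real n)"
  have \<tau>0: "\<tau> \<ge> 0" using \<alpha> by (simp add: \<tau>_def)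
  have \<tau>: "\<bar>deviation g \<omega>\<bar> \<le> \<tau>" if "\<omega> \<in> E" "g \<in> \<G>" for \<omega> g
  proof -
    have "\<bar>deviation g \<omega>\<bar> \<le> (22 * K + 2 * l) / sqrt (real n) + 2 * (6 / real (q n))"
      using E_dev[OF that] chaining_budget[OF K l, of n]
      unfolding s_def q_def by (smt (verit) divide_right_mono real_sqrt_ge_zero of_nat_0_le_iff)
    also have "2 * (6 / real (q n)) \<le> K / sqrt (real n)"
    proof -
      have "sqrt (real n) \<le> sqrt (real n * real n)" using n by (intro real_sqrt_le_mono) simp
      also have "\<dots> = real n" by simp
      also have "\<dots> \<le> 2 ^ n" using of_nat_less_two_power[of n, where 'a=real] by simp
      also have "(2::real) ^ n \<le> 4 ^ n" by (intro power_mono) auto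
      finally have "sqrt (real n) \<le> 4 ^ n" .
      moreover have "0 \<le> (4::real) ^ n" by simp
      ultimately have "sqrt (real n) * 12 \<le> 64 * 4 ^ n" by linarith
      then have "2 * (6 / real (q n)) \<le> 1 / sqrt (real n)" using n by (simp add: q_def field_simps)
      also have "\<dots> \<le> K / sqrt (real n)" using K by (intro divide_right_mono) auto
      finally show ?thesis .
    qed
    also have "(22 * K + 2 * l) / sqrt (real n) + K / sqrt (real n) = (23 * K + 2 * l) / sqrt (real n)"
      by (simp add: add_divide_distrib[symmetric])
    also have "2 * l = sqrt (2 * ln (1 / \<alpha>))"
    proof -
      have "2 * l = sqrt 4 * sqrt (ln (1 / \<alpha>) / 2)" by (simp add: l_def)
      also have "\<dots> = sqrt (4 * (ln (1 / \<alpha>) / 2))" by (rule real_sqrt_mult[symmetric])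
      finally show ?thesis by simp
    qed
    finally show ?thesis by (simp add: \<tau>_def K_def)
  qed
  have "\<bar>deviation (\<lambda>z. h (u \<bullet> z)) \<omega>\<bar> \<le> L * N u * D * \<tau>"
    if \<omega>: "\<omega> \<in> E" and h: "L-lipschitz_on UNIV h" for \<omega> u L h
  proof -
    have L: "L \<ge> 0" by (rule lipschitz_on_nonneg[OF h])
    have h': "\<bar>h x - h y\<bar> \<le> L * \<bar>x - y\<bar>" for x y
      using lipschitz_onD[OF h, of x y] by (simp add: dist_real_def)
    define \<kappa> where "\<kappa> = L * N u * D"
    have \<kappa>0: "\<kappa> \<ge> 0" using L D is_normD(1)[OF N, of u] by (simp add: \<kappa>_def)
    have osc: "\<bar>h (u \<bullet> z) - h (u \<bullet> z0)\<bar> \<le> \<kappa>" if "z \<in> S" for z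
    proof -
      have "\<bar>h (u \<bullet> z) - h (u \<bullet> z0)\<bar> \<le> L * \<bar>u \<bullet> (z - z0)\<bar>"
        using h'[of "u \<bullet> z" "u \<bullet> z0"] by (simp add: inner_diff_right)
      also have "\<dots> \<le> L * (N u * D)" using L D(2)[OF that z0] by (intro mult_left_mono) auto
      finally show ?thesis by (simp add: \<kappa>_def)
    qed
    have meas: "(\<lambda>z. h (u \<bullet> z)) \<in> borel_measurable borel" using lip_meas[OF h, of "\<lambda>z. z"] by simp
    have int: "integrable P (\<lambda>z. h (u \<bullet> z))"
      by (rule integrable_of_bounded_on_S[OF meas, of "\<bar>h (u \<bullet> z0)\<bar> + \<kappa>"]) (use osc in force)
    show ?thesis
    proof (cases "\<kappa> = 0")
      case True
      have "\<bar>deviation (\<lambda>z. (h (u \<bullet> z) - h (u \<bullet> z0)) / 1) \<omega>\<bar> \<le> 2 * 0"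
        using osc True int E(2)[OF \<omega>] by (intro deviation_le_of_bounded) auto
      then show ?thesis unfolding deviation_affine[OF int] \<kappa>_def[symmetric] True by simp
    next
      case False
      then have pos: "\<kappa> > 0" "L > 0" "N u > 0" "D > 0"
        using \<kappa>0 L D is_normD(1)[OF N, of u] by (auto simp: \<kappa>_def order_less_le)
      \<comment> \<open>The profile of \<open>h\<close> in the normalized coordinates.\<close>
      define k where "k x = (h (D * N u * x + u \<bullet> z0) - h (- (D * N u) + u \<bullet> z0)) / \<kappa>" for x
      have "1-lipschitz_on UNIV k"
      proof (rule lipschitz_onI)
        fix x y
        have "\<bar>h (D * N u * x + u \<bullet> z0) - h (D * N u * y + u \<bullet> z0)\<bar> \<le> L * \<bar>D * N u * x - D * N u * y\<bar>"
          using h'[of "D * N u * x + u \<bullet> z0" "D * N u * y + u \<bullet> z0"] by simp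
        also have "\<dots> = \<kappa> * \<bar>x - y\<bar>"
          using pos by (simp add: \<kappa>_def abs_mult right_diff_distrib[symmetric])
        finally show "dist (k x) (k y) \<le> 1 * dist x y"
          using pos(1) by (simp add: k_def dist_real_def diff_divide_distrib[symmetric] abs_divide field_simps)
      qed simp
      moreover have "N ((1 / N u) *\<^sub>R u) \<le> 1" using pos by (simp add: is_normD(3)[OF N])
      moreover have "k (-1) = 0" by (simp add: k_def)
      ultimately have "(\<lambda>z. k (((1 / N u) *\<^sub>R u) \<bullet> \<phi> z)) \<in> \<G>"
        unfolding \<G>_def mem_Collect_eq by (intro exI[of _ "(1 / N u) *\<^sub>R u"] exI[of _ k] conjI refl)
      moreover have "k (((1 / N u) *\<^sub>R u) \<bullet> \<phi> z) = (h (u \<bullet> z) - h (- (D * N u) + u \<bullet> z0)) / \<kappa>" for z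
      proof -
        have "D * N u * (((1 / N u) *\<^sub>R u) \<bullet> \<phi> z) + u \<bullet> z0 = u \<bullet> z"
          using pos by (simp add: \<phi>_def D1_def inner_diff_right diff_divide_distrib[symmetric])
        then show ?thesis by (simp only: k_def)
      qed
      ultimately have "\<bar>deviation (\<lambda>z. (h (u \<bullet> z) - h (- (D * N u) + u \<bullet> z0)) / \<kappa>) \<omega>\<bar> \<le> \<tau>"
        using \<tau>[OF \<omega>] by simp
      then have "\<bar>deviation (\<lambda>z. h (u \<bullet> z)) \<omega>\<bar> \<le> \<kappa> * \<tau>"
        unfolding deviation_affine[OF int] using pos(1) by (simp add: abs_divide divide_le_eq mult.commute)
      then show ?thesis by (simp only: \<kappa>_def)
    qed
  qed
  then show ?thesis using E E_prob' unfolding \<tau>_def m_def by (intro bexI[of _ E]) auto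
qed

section \<open>Supports and empirical measures\<close>

text \<open>
  The complement of the support is a union of null sets from a countable basis.
\<close>

lemma AE_in_supp:
  fixes P :: "'a::second_countable_topology measure"
  assumes "sets P = sets borel"
  shows "AE z in P. z \<in> supp P"
proof -
  obtain \<B> :: "'a set set" where \<B>: "countable \<B>" "topological_basis \<B>" using ex_countable_basis by blast
  define \<N> where "\<N> = {U \<in> \<B>. emeasure P U = 0}"
  have "(\<Union>U\<in>\<N>. U) \<in> null_sets P"
  proof (rule null_sets_UN')
    show "countable \<N>" using \<B>(1) by (auto simp: \<N>_def)
    show "U \<in> null_sets P" if "U \<in> \<N>" for U
      using that topological_basis_open[OF \<B>(2)] by (auto simp: \<N>_def assms null_sets_def)
  qed
  moreover have "{z \<in> space P. z \<notin> supp P} \<subseteq> (\<Union>U\<in>\<N>. U)"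
  proof
    fix z assume "z \<in> {z \<in> space P. z \<notin> supp P}"
    then obtain U where U: "open U" "z \<in> U" "emeasure P U = 0" by (auto simp: supp_def)
    then obtain V where V: "V \<in> \<B>" "z \<in> V" "V \<subseteq> U" using topological_basisE[OF \<B>(2)] by blast
    have "emeasure P V \<le> emeasure P U" using U V by (intro emeasure_mono) (auto simp: assms)
    then show "z \<in> (\<Union>U\<in>\<N>. U)" using U V by (auto simp: \<N>_def)
  qed
  ultimately show ?thesis by (rule AE_I')
qed

lemma sets_empirical_measure: "sets (empirical_measure n z) = sets borel"
  by (simp add: empirical_measure_def)

lemma prob_space_empirical_measure:
  assumes "n \<ge> 1"
  shows "prob_space (empirical_measure n z)"
proof -
  interpret U: prob_space "uniform_count_measure {..<n}"
    using assms by (intro prob_space_uniform_count_measure) (auto simp: lessThan_empty_iff)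
  show ?thesis unfolding empirical_measure_def
    by (rule U.prob_space_distr) (simp add: measurable_cong_sets[OF sets_uniform_count_measure_count_space refl])
qed

lemma integral_empirical_measure:
  fixes f :: "'a::topological_space \<Rightarrow> real"
  assumes "f \<in> borel_measurable borel"
  shows "(\<integral>x. f x \<partial>empirical_measure n z) = (\<Sum>i<n. f (z i)) / real n"
proof -
  have "(\<integral>x. f x \<partial>empirical_measure n z) = (\<integral>i. f (z i) \<partial>uniform_count_measure {..<n})"
    unfolding empirical_measure_def
    by (rule integral_distr[OF _ assms]) (simp add: measurable_cong_sets[OF sets_uniform_count_measure_count_space refl])
  also have "\<dots> = (\<Sum>i<n. f (z i)) / real n"
    by (simp add: uniform_count_measure_def lebesgue_integral_point_measure_finite sum_divide_distrib)
  finally show ?thesis .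
qed

lemma AE_empirical_measure:
  assumes "S \<in> sets borel" "\<And>i. i < n \<Longrightarrow> z i \<in> S"
  shows "AE x in empirical_measure n z. x \<in> S"
proof -
  have "AE i in uniform_count_measure {..<n}. z i \<in> S"
    unfolding uniform_count_measure_def AE_point_measure using assms(2) by auto
  moreover have "z \<in> uniform_count_measure {..<n} \<rightarrow>\<^sub>M borel"
    by (simp add: measurable_cong_sets[OF sets_uniform_count_measure_count_space refl])
  ultimately show ?thesis
    unfolding empirical_measure_def using assms(1) by (subst AE_distr_iff) auto
qed

section \<open>The worst-case risk\<close>

lemma convex_conjugate_subgradient:
  assumes "b \<in> subdifferential \<rho> \<beta>"
  shows "convex_conjugate \<rho> b = ereal (b \<bullet> \<beta> - \<rho> \<beta>)"
  unfolding convex_conjugate_def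
proof (rule antisym)
  show "(SUP x. ereal (b \<bullet> x - \<rho> x)) \<le> ereal (b \<bullet> \<beta> - \<rho> \<beta>)"
    using assms by (intro SUP_least) (auto simp: subdifferential_def inner_diff_right algebra_simps)
  show "ereal (b \<bullet> \<beta> - \<rho> \<beta>) \<le> (SUP x. ereal (b \<bullet> x - \<rho> x))"
    by (rule SUP_upper) simp
qed

text \<open>
  Equality in the Fenchel-Young inequality: the conjugate at a subgradient \<open>b\<close> is \<open>b \<bullet> \<beta> - \<rho> \<beta>\<close>.
\<close>

lemma inner_shift_direction:
  assumes "b \<in> subdifferential \<rho> \<beta>" "\<beta> \<noteq> 0"
  shows "\<beta> \<bullet> shift_direction \<rho> \<beta> b = \<rho> \<beta>"
  using assms
  by (simp add: shift_direction_def convex_conjugate_subgradient inner_diff_right inner_commute)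

text \<open>
  At \<open>\<gamma> = t \<beta>\<close>, admissibility gives \<open>\<bar>t\<bar> * \<rho> \<beta> \<le> \<rho> (t \<beta>)\<close>. Used at \<open>t \<beta>\<close> with factor \<open>1 / t\<close>, this is the
  reverse inequality, so \<open>\<rho>\<close> is linear along open rays. By convexity, \<open>\<rho> 0\<close> is at most the mean of
  \<open>\<rho> (t \<beta>)\<close> and \<open>\<rho> (- t \<beta>)\<close>, which tends to \<open>0\<close> with \<open>t\<close>. The value at \<open>0\<close> is needed because the
  shift direction of \<open>\<beta> = 0\<close> contributes nothing to the residual of \<open>\<beta>\<close>.
\<close>

lemma admissible_penalty_zero:
  fixes \<rho> :: "real^'d \<Rightarrow> real"
  assumes nonneg: "\<And>x. 0 \<le> \<rho> x" and conv: "convex_on UNIV \<rho>"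
    and adm: "\<And>\<beta>. admissible_subgradients \<rho> \<beta> \<noteq> {}"
  shows "\<rho> 0 = 0"
proof -
  have hom: "\<bar>t\<bar> * \<rho> \<beta> \<le> \<rho> (t *\<^sub>R \<beta>)" if "\<beta> \<noteq> 0" for t \<beta>
  proof -
    obtain b where "b \<in> admissible_subgradients \<rho> \<beta>" using adm[of \<beta>] by blast
    then have b: "b \<in> subdifferential \<rho> \<beta>" "\<bar>(t *\<^sub>R \<beta>) \<bullet> shift_direction \<rho> \<beta> b\<bar> \<le> \<rho> (t *\<^sub>R \<beta>)"
      unfolding admissible_subgradients_def by blast+
    then show ?thesis using inner_shift_direction[OF b(1) that] nonneg[of \<beta>] by (simp add: abs_mult)
  qed
  define \<beta> :: "real^'d" where "\<beta> = axis undefined 1"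
  have \<beta>: "\<beta> \<noteq> 0" by (simp add: \<beta>_def)
  have small: "\<rho> (t *\<^sub>R x) \<le> t * \<rho> x" if "t > 0" "x \<noteq> 0" for t x
    using hom[of "t *\<^sub>R x" "1 / t"] that by (simp add: field_simps)
  have le: "\<rho> 0 \<le> t * ((\<rho> \<beta> + \<rho> (- \<beta>)) / 2)" if "t > 0" for t
  proof -
    have "\<rho> ((1 - 1/2) *\<^sub>R (t *\<^sub>R \<beta>) + (1/2) *\<^sub>R (t *\<^sub>R (- \<beta>)))
        \<le> (1 - 1/2) * \<rho> (t *\<^sub>R \<beta>) + (1/2) * \<rho> (t *\<^sub>R (- \<beta>))"
      by (rule convex_onD[OF conv]) auto
    moreover have "(1 - 1/2 :: real) *\<^sub>R (t *\<^sub>R \<beta>) + (1/2) *\<^sub>R (t *\<^sub>R (- \<beta>)) = 0" by simp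
    ultimately show ?thesis using small[OF that \<beta>] small[OF that, of "- \<beta>"] \<beta> by (simp add: algebra_simps)
  qed
  define c where "c = (\<rho> \<beta> + \<rho> (- \<beta>)) / 2"
  have c: "\<rho> 0 \<le> t * c" if "t > 0" for t using le[OF that] by (simp add: c_def)
  show ?thesis
  proof (rule ccontr)
    assume "\<rho> 0 \<noteq> 0"
    then have 0: "\<rho> 0 > 0" using nonneg[of 0] by simp
    then have "c > 0" using c[of 1] by simp
    then show False using c[of "\<rho> 0 / (2 * c)"] 0 by simp
  qed
qed

lemma resid_eq_inner: "resid \<gamma> z = (- \<gamma>, 1) \<bullet> z"
  by (simp add: resid_def inner_prod_def inner_commute)

lemma borel_measurable_resid [measurable]: "resid \<gamma> \<in> borel_measurable borel"
proof -
  have "(\<lambda>z. (- \<gamma>, 1) \<bullet> z) \<in> borel_measurable borel"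
    by (intro borel_measurable_continuous_onI continuous_intros)
  then show ?thesis by (simp add: resid_eq_inner[abs_def])
qed

text \<open>
  The perturbation moves the residual of \<open>\<beta>\<close> by \<open>e (\<sigma> + \<beta> \<bullet> v)\<close>, where \<open>v\<close> is the shift direction and
  \<open>\<beta> \<bullet> v = \<rho> \<beta>\<close>. As \<open>e\<close> is itself proportional to the residual, the residual is multiplied by a constant.
\<close>

lemma worst_case_risk_eq:
  fixes \<rho> :: "real^'d \<Rightarrow> real"
  assumes r: "r \<ge> 1" and \<sigma>: "\<sigma> \<ge> 0" and \<delta>: "\<delta> \<ge> 0" and nonneg: "\<And>x. 0 \<le> \<rho> x" and \<rho>0: "\<rho> 0 = 0"
    and P: "sets P = sets borel" and sup: "sup_achieved_at_worst_case_law r \<rho> \<sigma> \<delta> P B \<beta>"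
  shows "worst_case_risk r B \<beta> = ereal (risk r P \<beta> + \<delta> * (\<sigma> + \<rho> \<beta>))"
proof -
  obtain b where b: "b \<in> admissible_subgradients \<rho> \<beta>"
    and eq: "worst_case_risk r B \<beta> = ereal (risk r (worst_case_law r \<rho> \<sigma> \<delta> P \<beta> b) \<beta>)" and R: "risk r P \<beta> > 0"
    using sup by (auto simp: sup_achieved_at_worst_case_law_def)
  have shift: "\<beta> \<bullet> shift_direction \<rho> \<beta> b = \<rho> \<beta>"
    using b inner_shift_direction[of b \<rho> \<beta>] \<rho>0 by (cases "\<beta> = 0") (auto simp: admissible_subgradients_def)
  define R where "R = risk r P \<beta>"
  define k where "k = 1 + \<delta> * (\<sigma> + \<rho> \<beta>) / R"
  have k: "k \<ge> 0" using R \<sigma> \<delta> nonneg[of \<beta>] by (simp add: k_def R_def)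
  define T where "T = (\<lambda>z. let e = \<delta> * resid \<beta> z / risk r P \<beta> in
       (fst z - e *\<^sub>R shift_direction \<rho> \<beta> b, snd z + \<sigma> * e))"
  have T: "resid \<beta> (T z) = k * resid \<beta> z" for z
  proof -
    define e where "e = \<delta> * resid \<beta> z / R"
    have "T z = (fst z - e *\<^sub>R shift_direction \<rho> \<beta> b, snd z + \<sigma> * e)"
      by (simp add: T_def e_def R_def Let_def)
    then have "resid \<beta> (T z) = resid \<beta> z + e * (\<sigma> + \<beta> \<bullet> shift_direction \<rho> \<beta> b)"
      by (simp add: resid_def inner_diff_left inner_diff_right inner_commute algebra_simps)
    then show ?thesis unfolding shift by (simp add: k_def e_def algebra_simps add_divide_distrib)
  qed
  have T_meas: "T \<in> P \<rightarrow>\<^sub>M borel"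
  proof -
    have "(\<lambda>z. (fst z - (\<delta> * resid \<beta> z / risk r P \<beta>) *\<^sub>R shift_direction \<rho> \<beta> b,
        snd z + \<sigma> * (\<delta> * resid \<beta> z / risk r P \<beta>))) \<in> borel \<rightarrow>\<^sub>M borel"
      unfolding resid_eq_inner divide_inverse
      by (intro borel_measurable_continuous_onI continuous_intros)
    then show ?thesis unfolding T_def Let_def using measurable_cong_sets[OF P refl] by blast
  qed
  have "worst_case_law r \<rho> \<sigma> \<delta> P \<beta> b = distr P borel T"
    by (simp only: worst_case_law_def T_def)
  then have "risk r (worst_case_law r \<rho> \<sigma> \<delta> P \<beta> b) \<beta> = (\<integral>z. \<bar>resid \<beta> (T z)\<bar> powr r \<partial>P) powr (1 / r)"
    using integral_distr[OF T_meas, of "\<lambda>z. \<bar>resid \<beta> z\<bar> powr r"] by (simp add: risk_def)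
  also have "\<dots> = (k powr r * (\<integral>z. \<bar>resid \<beta> z\<bar> powr r \<partial>P)) powr (1 / r)"
    using k by (simp add: T abs_mult powr_mult)
  also have "\<dots> = k * R"
    using k r by (simp add: powr_mult powr_powr R_def risk_def)
  also have "\<dots> = R + \<delta> * (\<sigma> + \<rho> \<beta>)" using R by (simp add: k_def R_def field_simps)
  finally show ?thesis using eq by (simp add: R_def)
qed

section \<open>The test statistic\<close>

text \<open>
  The residual of \<open>\<gamma>\<close> is the projection in direction \<open>(-\<gamma>, 1)\<close>, which varies by at most
  \<open>N (\<gamma>, -1) * D\<close> on \<open>S\<close>. This length enters the comparison of moments with power \<open>r - 1\<close> from the interval
  and power \<open>1\<close> from the deviation, so the \<open>r\<close>-th root is linear in it.
\<close>

lemma risk_diff_le: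
  fixes N :: "'d::finite point \<Rightarrow> real" and P Q :: "'d point measure"
  assumes P: "prob_space P" "sets P = sets borel" "AE z in P. z \<in> S"
    and Q: "prob_space Q" "sets Q = sets borel" "AE z in Q. z \<in> S"
    and r: "r \<ge> 1" and N: "is_norm N" and S: "bounded S" and D: "D \<ge> 0" and \<tau>: "\<tau> \<ge> 0"
    and diam: "\<And>u z z'. z \<in> S \<Longrightarrow> z' \<in> S \<Longrightarrow> \<bar>u \<bullet> (z - z')\<bar> \<le> N u * D"
    and lip: "\<And>u L h. L-lipschitz_on UNIV h \<Longrightarrow>
      \<bar>(\<integral>z. h (u \<bullet> z) \<partial>P) - (\<integral>z. h (u \<bullet> z) \<partial>Q)\<bar> \<le> L * N u * D * \<tau>"
  shows "risk r P \<gamma> \<le> risk r Q \<gamma> + N (\<gamma>, -1) * D * \<tau> powr (1 / r)"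
proof -
  define u :: "'d point" where "u = (- \<gamma>, 1)"
  have Nu: "N u = N (\<gamma>, -1)" using is_normD(6)[OF N, of u] by (simp add: u_def)
  have res: "resid \<gamma> = (\<bullet>) u" by (rule ext) (simp add: u_def resid_eq_inner)
  define Du where "Du = N u * D"
  have Du: "Du \<ge> 0" using D is_normD(1)[OF N, of u] by (simp add: Du_def)
  have "risk r P \<gamma> \<le> risk r Q \<gamma> + (Du powr (r - 1) * (Du * \<tau>)) powr (1 / r)"
    unfolding risk_def res
  proof (rule Lr_norm_le_of_lipschitz_integrals[where I="(\<bullet>) u ` S"])
    show "AE z in P. u \<bullet> z \<in> (\<bullet>) u ` S" "AE z in Q. u \<bullet> z \<in> (\<bullet>) u ` S"
      using P(3) Q(3) by (auto elim!: eventually_mono)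
    show "(\<bullet>) u \<in> borel_measurable P" "(\<bullet>) u \<in> borel_measurable Q"
      by (simp_all add: measurable_cong_sets[OF P(2) refl] measurable_cong_sets[OF Q(2) refl])
    show "bounded ((\<bullet>) u ` S)" using S by (intro bounded_linear_image bounded_linear_inner_right)
    show "\<bar>x - y\<bar> \<le> Du" if "x \<in> (\<bullet>) u ` S" "y \<in> (\<bullet>) u ` S" for x y
      using that diam[of _ _ u] by (auto simp: Du_def inner_diff_right)
    show "(\<integral>z. h (u \<bullet> z) \<partial>P) \<le> (\<integral>z. h (u \<bullet> z) \<partial>Q) + L * (Du * \<tau>)" if "L-lipschitz_on UNIV h" for L h
      using lip[OF that, of u] by (simp add: Du_def mult.assoc)
  qed (use P Q r Du \<tau> in auto)
  also have "(Du powr (r - 1) * (Du * \<tau>)) powr (1 / r) = Du * \<tau> powr (1 / r)"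
  proof (cases "Du = 0")
    case False
    then have "Du powr (r - 1) * (Du * \<tau>) = Du powr r * \<tau>"
      using Du powr_add[of Du "r - 1" 1] by simp
    then have "(Du powr (r - 1) * (Du * \<tau>)) powr (1 / r) = (Du powr r * \<tau>) powr (1 / r)" by (rule arg_cong)
    also have "\<dots> = Du * \<tau> powr (1 / r)" using Du \<tau> r by (simp add: powr_mult powr_powr)
    finally show ?thesis .
  qed simp
  finally show ?thesis by (simp add: Du_def Nu)
qed

text \<open>
  Each of the two fluctuations is at most \<open>\<epsilon>\<close> times its own part of the denominator, hence the quotient of
  the sums is at most \<open>\<epsilon>\<close>.
\<close>

lemma test_statistic_le:
  assumes "\<sigma> > 0" "\<rho> \<beta>1 \<ge> 0" "\<rho> \<beta>2 \<ge> 0"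
    and le: "risk r P \<beta>1 + \<delta> * \<rho> \<beta>1 \<le> risk r P \<beta>2 + \<delta> * \<rho> \<beta>2"
    and 1: "risk r Pn \<beta>1 \<le> risk r P \<beta>1 + (\<sigma> + \<rho> \<beta>1) * \<epsilon>"
    and 2: "risk r P \<beta>2 \<le> risk r Pn \<beta>2 + (\<sigma> + \<rho> \<beta>2) * \<epsilon>"
  shows "test_statistic r \<rho> \<sigma> \<delta> n Pn \<beta>1 \<beta>2 \<le> real n powr (1 / (2 * r)) * \<epsilon>"
proof -
  have "risk r Pn \<beta>1 - risk r Pn \<beta>2 + \<delta> * \<rho> \<beta>1 - \<delta> * \<rho> \<beta>2 \<le> \<epsilon> * (2 * \<sigma> + \<rho> \<beta>1 + \<rho> \<beta>2)"
    using le 1 2 by (simp add: algebra_simps)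
  moreover have "2 * \<sigma> + \<rho> \<beta>1 + \<rho> \<beta>2 > 0" using assms by simp
  ultimately show ?thesis unfolding test_statistic_def
    by (intro mult_left_mono) (simp_all add: divide_le_eq)
qed

theorem corollary2:
  fixes r \<sigma> \<delta> \<alpha> c\<^sub>d C c\<^sub>\<rho> :: real
    and n :: nat
    and \<rho> :: "real^'d \<Rightarrow> real"
    and N :: "'d point \<Rightarrow> real"
    and P :: "'d point measure"
    and B :: "'d point measure set"
    and M :: "'w measure"
    and Z :: "nat \<Rightarrow> 'w \<Rightarrow> 'd point"
    and Pn :: "'w \<Rightarrow> 'd point measure"
    and \<beta>1 \<beta>2 :: "'d point measure \<Rightarrow> real^'d"
  assumes "r \<ge> 1" and "\<sigma> \<ge> 1" and "\<delta> \<ge> 0" and "0 < \<alpha>" and "\<alpha> < 1"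
    and "\<forall>x. 0 \<le> \<rho> x" and "convex_on UNIV \<rho>"
    and "\<forall>\<beta>. admissible_subgradients \<rho> \<beta> \<noteq> {}"
    and "is_norm N" and "c\<^sub>d > 0"
    and "\<forall>\<gamma>. c\<^sub>d * N (\<gamma>, -1) \<le> \<rho> \<gamma> + 1"
    and "prob_space P" and "sets P = sets borel" and "compact (supp P)"
    and "prob_space M" and "n \<ge> 1"
    and "prob_space.indep_vars M (\<lambda>_. borel) Z {..<n}"
    and "\<forall>i<n. distr M borel (Z i) = P"
    and Pn: "\<And>\<omega>. Pn \<omega> = empirical_measure n (\<lambda>i. Z i \<omega>)"
    and C: "C = (180 * sqrt (real CARD('d) + 2) + sqrt (2 * ln (1 / \<alpha>))) *
               diam (dual_norm N) (supp P) powr r"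
    and c\<rho>: "c\<^sub>\<rho> = max (1 / c\<^sub>d) 1"
    and "(\<lambda>\<omega>. \<beta>1 (Pn \<omega>)) \<in> borel_measurable M"
    and "(\<lambda>\<omega>. \<beta>2 (Pn \<omega>)) \<in> borel_measurable M"
    and "B \<subseteq> wasserstein_ball r \<rho> \<sigma> \<delta> P"
    and "AE \<omega> in M. sup_achieved_at_worst_case_law r \<rho> \<sigma> \<delta> P B (\<beta>1 (Pn \<omega>))"
    and "AE \<omega> in M. sup_achieved_at_worst_case_law r \<rho> \<sigma> \<delta> P B (\<beta>2 (Pn \<omega>))"
    and "AE \<omega> in M. worst_case_risk r B (\<beta>1 (Pn \<omega>)) \<le> worst_case_risk r B (\<beta>2 (Pn \<omega>))"
  shows "measure M {\<omega> \<in> space M.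
           test_statistic r \<rho> \<sigma> \<delta> n (Pn \<omega>) (\<beta>1 (Pn \<omega>)) (\<beta>2 (Pn \<omega>)) > c\<^sub>\<rho> * C powr (1 / r)} \<le> \<alpha>"
proof -
  note r = assms(1) and \<sigma> = assms(2) and \<delta> = assms(3) and \<alpha> = assms(4,5) and \<rho>_conv = assms(7)
    and N = assms(9) and c\<^sub>d = assms(10,11) and P = assms(12,13) and cpt = assms(14) and n = assms(16)
  have \<rho>: "\<rho> x \<ge> 0" for x using assms(6) by blast
  interpret M: prob_space M by fact
  interpret P: prob_space P by fact
  define S where "S = supp P"
  have S_meas: "S \<in> sets borel" using cpt by (simp add: S_def borel_compact)
  have S_AE: "AE z in P. z \<in> S" unfolding S_def by (rule AE_in_supp[OF P(2)])
  interpret iid_sample M P Z n S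
    by unfold_locales (use assms(17,18) n S_meas S_AE in auto)
  define D where "D = diam (dual_norm N) S"
  have diam: "\<bar>u \<bullet> (z - z')\<bar> \<le> N u * D" if "z \<in> S" "z' \<in> S" for u z z'
  proof -
    have "\<bar>u \<bullet> (z - z')\<bar> \<le> N u * dual_norm N (z - z')" by (rule inner_le_dual_norm[OF N])
    also have "\<dots> \<le> N u * D"
      unfolding D_def using that cpt by (intro mult_left_mono dual_norm_le_diam[OF N] is_normD(1)[OF N]) (auto simp: S_def)
    finally show ?thesis .
  qed
  have D: "D \<ge> 0"
  proof -
    obtain z where z: "z \<in> S" using S_nonempty by auto
    have "N (0, 1) > 0" using is_normD(1,2)[OF N, of "(0, 1)"] by (simp add: order_less_le zero_prod_def)
    then show ?thesis using diam[OF z z, of "(0, 1)"] by (simp add: zero_le_mult_iff)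
  qed
  define \<tau> where "\<tau> = (23 * sqrt (real CARD('d) + 2) + sqrt (2 * ln (1 / \<alpha>))) / sqrt (real n)"
  have \<tau>: "\<tau> \<ge> 0" using \<alpha> by (simp add: \<tau>_def)
  have dim: "real (DIM('d point) + 1) = real CARD('d) + 2" by simp
  obtain E where E: "E \<in> sets M" "M.prob E \<ge> 1 - \<alpha>" "\<And>\<omega>. \<omega> \<in> E \<Longrightarrow> \<forall>i<n. Z i \<omega> \<in> S"
    and dev: "\<And>\<omega> u L h. \<omega> \<in> E \<Longrightarrow> L-lipschitz_on UNIV h \<Longrightarrow>
      \<bar>deviation (\<lambda>z. h (u \<bullet> z)) \<omega>\<bar> \<le> L * N u * D * \<tau>"
    using lipschitz_projection_concentration[OF iid_sample_axioms N D diam \<alpha>]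
    unfolding dim \<tau>_def[symmetric] by blast
  define \<epsilon> where "\<epsilon> = D * \<tau> powr (1 / r) / c\<^sub>d"
  have \<epsilon>: "N (\<gamma>, -1) * D * \<tau> powr (1 / r) \<le> (\<sigma> + \<rho> \<gamma>) * \<epsilon>" for \<gamma>
  proof -
    have "N (\<gamma>, -1) \<le> (\<sigma> + \<rho> \<gamma>) / c\<^sub>d"
      using c\<^sub>d(1) c\<^sub>d(2)[rule_format, of \<gamma>] \<sigma> by (simp add: le_divide_eq mult.commute)
    then have "N (\<gamma>, -1) * (D * \<tau> powr (1 / r)) \<le> (\<sigma> + \<rho> \<gamma>) / c\<^sub>d * (D * \<tau> powr (1 / r))"
      using D by (intro mult_right_mono) auto
    then show ?thesis by (simp add: \<epsilon>_def mult.assoc)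
  qed
  have risks: "risk r (Pn \<omega>) \<gamma> \<le> risk r P \<gamma> + (\<sigma> + \<rho> \<gamma>) * \<epsilon>"
    "risk r P \<gamma> \<le> risk r (Pn \<omega>) \<gamma> + (\<sigma> + \<rho> \<gamma>) * \<epsilon>" if \<omega>: "\<omega> \<in> E" for \<omega> \<gamma>
  proof -
    have Q: "prob_space (Pn \<omega>)" "sets (Pn \<omega>) = sets borel" "AE z in Pn \<omega>. z \<in> S"
      unfolding Pn using E(3)[OF \<omega>]
      by (auto intro: prob_space_empirical_measure[OF n] AE_empirical_measure[OF S_meas]
               simp: sets_empirical_measure)
    have lip: "\<bar>(\<integral>z. h (u \<bullet> z) \<partial>Pn \<omega>) - (\<integral>z. h (u \<bullet> z) \<partial>P)\<bar> \<le> L * N u * D * \<tau>"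
      if h: "L-lipschitz_on UNIV h" for u L h
    proof -
      have "h \<in> borel_measurable borel"
        by (rule borel_measurable_continuous_onI[OF lipschitz_on_continuous_on[OF h]])
      then have "(\<lambda>z. h (u \<bullet> z)) \<in> borel_measurable borel" by simp
      then show ?thesis using dev[OF \<omega> h, of u]
        by (simp add: Pn integral_empirical_measure deviation_def)
    qed
    have bdd: "bounded S" using cpt by (simp add: S_def compact_imp_bounded)
    show "risk r (Pn \<omega>) \<gamma> \<le> risk r P \<gamma> + (\<sigma> + \<rho> \<gamma>) * \<epsilon>"
      by (rule order_trans[OF risk_diff_le[OF Q P S_AE r N bdd D \<tau> diam lip] add_left_mono[OF \<epsilon>]])
    show "risk r P \<gamma> \<le> risk r (Pn \<omega>) \<gamma> + (\<sigma> + \<rho> \<gamma>) * \<epsilon>"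
      by (rule order_trans[OF risk_diff_le[OF P S_AE Q r N bdd D \<tau> diam] add_left_mono[OF \<epsilon>]])
         (use lip in \<open>auto simp: abs_minus_commute\<close>)
  qed
  \<comment> \<open>The rate \<open>n powr (1 / (2 * r))\<close> is the \<open>r\<close>-th root of \<open>sqrt n\<close> and cancels the one in \<open>\<tau>\<close>.\<close>
  have thr: "real n powr (1 / (2 * r)) * \<epsilon> \<le> c\<^sub>\<rho> * C powr (1 / r)"
  proof -
    define A where "A = 180 * sqrt (real CARD('d) + 2) + sqrt (2 * ln (1 / \<alpha>))"
    have A: "A \<ge> 0" using \<alpha> by (simp add: A_def)
    have "real n powr (1 / (2 * r)) = sqrt (real n) powr (1 / r)"
      by (simp add: powr_half_sqrt[symmetric] powr_powr)
    then have "real n powr (1 / (2 * r)) * \<tau> powr (1 / r) = (sqrt (real n) * \<tau>) powr (1 / r)"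
      using \<tau> by (simp add: powr_mult)
    also have "\<dots> \<le> A powr (1 / r)"
    proof (rule powr_mono2)
      show "sqrt (real n) * \<tau> \<le> A" using n by (simp add: \<tau>_def A_def)
    qed (use r \<tau> in auto)
    finally have "D * (real n powr (1 / (2 * r)) * \<tau> powr (1 / r)) \<le> D * A powr (1 / r)"
      using D by (rule mult_left_mono)
    also have "D * A powr (1 / r) = C powr (1 / r)"
      using r A D unfolding C D_def[unfolded S_def, symmetric] A_def[symmetric] by (simp add: powr_mult powr_powr)
    finally have "real n powr (1 / (2 * r)) * \<epsilon> \<le> 1 / c\<^sub>d * C powr (1 / r)"
      using c\<^sub>d(1) by (simp add: \<epsilon>_def divide_right_mono field_simps)
    also have "\<dots> \<le> c\<^sub>\<rho> * C powr (1 / r)" unfolding c\<rho> by (intro mult_right_mono) auto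
    finally show ?thesis .
  qed
  have \<rho>0: "\<rho> 0 = 0" by (rule admissible_penalty_zero[OF \<rho> \<rho>_conv]) (use assms(8) in blast)
  have "AE \<omega> in M. \<omega> \<in> E \<longrightarrow>
    test_statistic r \<rho> \<sigma> \<delta> n (Pn \<omega>) (\<beta>1 (Pn \<omega>)) (\<beta>2 (Pn \<omega>)) \<le> c\<^sub>\<rho> * C powr (1 / r)"
    using assms(25-27)
  proof eventually_elim
    case (elim \<omega>)
    show ?case
    proof
      assume \<omega>: "\<omega> \<in> E"
      have "\<sigma> \<ge> 0" using \<sigma> by simp
      note wc = worst_case_risk_eq[where \<rho>=\<rho> and B=B, OF r this \<delta> \<rho> \<rho>0 P(2)]
      have "risk r P (\<beta>1 (Pn \<omega>)) + \<delta> * \<rho> (\<beta>1 (Pn \<omega>)) \<le> risk r P (\<beta>2 (Pn \<omega>)) + \<delta> * \<rho> (\<beta>2 (Pn \<omega>))"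
        using elim(3) by (simp add: wc[OF elim(1)] wc[OF elim(2)] algebra_simps)
      then have "test_statistic r \<rho> \<sigma> \<delta> n (Pn \<omega>) (\<beta>1 (Pn \<omega>)) (\<beta>2 (Pn \<omega>)) \<le> real n powr (1 / (2 * r)) * \<epsilon>"
        by (intro test_statistic_le[where P=P] risks[OF \<omega>]) (use \<sigma> \<rho> in auto)
      then show "test_statistic r \<rho> \<sigma> \<delta> n (Pn \<omega>) (\<beta>1 (Pn \<omega>)) (\<beta>2 (Pn \<omega>)) \<le> c\<^sub>\<rho> * C powr (1 / r)"
        using thr by linarith
    qed
  qed
  then have "M.prob {\<omega> \<in> space M. test_statistic r \<rho> \<sigma> \<delta> n (Pn \<omega>) (\<beta>1 (Pn \<omega>)) (\<beta>2 (Pn \<omega>)) > c\<^sub>\<rho> * C powr (1 / r)}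
      \<le> M.prob (space M - E)"
    using E(1) by (intro M.finite_measure_mono_AE) (auto elim!: eventually_mono)
  also have "\<dots> \<le> \<alpha>" using E(2) M.prob_compl[OF E(1)] by simp
  finally show ?thesis .
qed

end
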